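(* Let $\mathbb I=\{\,1\le i\le d-1 \mid i\notin\{a_1,\dots,a_{k-1}\},\ \delta_1(\mathbf w_i)>\deg(\mathbf w_i)\,\}$, and assume that $\mathbb I\ne\emptyset$. Then (i) $a_1(K[S])\ge\max_{i\in\mathbb I}\{\delta_1(\mathbf w_i),\ \delta_2(\mathbf w_i)\}-1$; (ii) $a_1(K[S])\le\max_{i\in\mathbb I}\{\delta_1(\mathbf w_i)+\delta_2(\mathbf w_i)-\deg(\mathbf w_i)\}-2$; (iii) $a_1(K[S])\le\left\lfloor\left(1-\frac{a_1}{d}\right)\max_{i\in\mathbb I}\{\delta_1(\mathbf w_i)\}+\frac{a_{k-1}}{d}\max_{i\in\mathbb I}\{\delta_2(\mathbf w_i)\}\right\rfloor-2$.
   Context: Let $K$ be a field, $\mathbb N$ the set of non-negative integers, $k\ge 3$, and let $0=:a_0<a_1<\cdots<a_k=:d$ be integers with $\gcd(a_1,\dots,a_k)=1$ and $k<d$. Put $A_1=\{0,a_1,\dots,a_k\}$, $A_2=\{d-a_i\mid 0\le i\le k\}$, and $\mathbf e_h=(h,d-h)$ for integers $0\le h\le d$. Let $S\subset\mathbb N^2$ be the additive monoid generated by $\mathbf e_{a_0},\dots,\mathbf e_{a_k}$, and $K[S]$ its semigroup ring (isomorphic to $K[s^{a_i}t^{d-a_i}\mid 0\le i\le k]$), graded by $\deg(u_1,u_2)=(u_1+u_2)/d$; $\mathfrak m$ is the maximal homogeneous ideal generated by $S\setminus\{0\}$. $H^i_{\mathfrak m}$ denotes local cohomology, and $a_i(K[S]):=\sup\{n\mid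 H^i_{\mathfrak m}(K[S])_n\ne 0\}$ (not to be confused with the integers $a_i$). For $i\in\{1,2\}$ let $\langle A_i\rangle$ be the submonoid of $\mathbb N$ generated by $A_i$. For $0\le j\le d-1$ let $\omega_i(j)=\min\{\alpha\in\langle A_i\rangle\mid\alpha\equiv j \bmod d\}$, and set $\omega_i(d):=0$. For $n\in\langle A_i\rangle$ let $\delta_i(n)$ be the minimum of $\sum_{a}x_a$ over all representations $n=\sum_{a\in A_i\setminus\{0\}}x_a a$ with $x_a\in\mathbb N$. For $0\le j\le d-1$ put $\mathbf w_j=(\omega_1(j),\omega_2(d-j))$, so $\deg(\mathbf w_j)=(\omega_1(j)+\omega_2(d-j))/d$, and write $\delta_1(\mathbf w_j)=\delta_1(\omega_1(j))$, $\delta_2(\mathbf w_j)=\delta_2(\omega_2(d-j))$. *)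

theory Defs
  imports
    "HOL-Library.Poly_Mapping"
    "HOL-Library.Product_Plus"
    "HOL-Library.Extended_Real"
    "HOL-Algebra.Module"
    "HOL-Algebra.Ideal_Product"
begin

section \<open>Graded modules and local cohomology\<close>

record 'a graded_ring = "'a ring" +
  ring_piece :: "int \<Rightarrow> 'a set"

record ('a, 'b) graded_module = "('a, 'b) module" +
  piece :: "int \<Rightarrow> 'b set"

text \<open>The last conjunct says that the module is the direct sum of its components.\<close>

definition is_graded_module :: "'r graded_ring \<Rightarrow> ('r, 'm) graded_module \<Rightarrow> bool" where
  "is_graded_module R M \<longleftrightarrow>
     Module.module R M \<and>
     (\<forall>n. additive_subgroup (piece M n) M) \<and>
     (\<forall>m n. \<forall>r\<in>ring_piece R m. \<forall>x\<in>piece M n. r \<odot>\<^bsub>M\<^esub> x \<in> piece M (m + n)) \<and>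
     (\<forall>x\<in>carrier M. \<exists>!c. (\<forall>n. c n \<in> piece M n) \<and> finite {n. c n \<noteq> \<zero>\<^bsub>M\<^esub>} \<and>
        x = (\<Oplus>\<^bsub>M\<^esub>n\<in>{n. c n \<noteq> \<zero>\<^bsub>M\<^esub>}. c n))"

definition self_module :: "'r graded_ring \<Rightarrow> ('r, 'r) graded_module" where
  "self_module R =
     \<lparr>carrier = carrier R, mult = mult R, one = one R, zero = zero R, add = add R,
      smult = mult R, piece = ring_piece R\<rparr>"

text \<open>Homomorphisms of graded modules are homogeneous of degree 0.\<close>

definition graded_hom ::
  "'r graded_ring \<Rightarrow> ('r, 'm) graded_module \<Rightarrow> ('r, 'n) graded_module \<Rightarrow> ('m \<Rightarrow> 'n) set" where
  "graded_hom R M N =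
     {f \<in> carrier M \<rightarrow> carrier N.
        (\<forall>x\<in>carrier M. \<forall>y\<in>carrier M. f (x \<oplus>\<^bsub>M\<^esub> y) = f x \<oplus>\<^bsub>N\<^esub> f y) \<and>
        (\<forall>r\<in>carrier R. \<forall>x\<in>carrier M. f (r \<odot>\<^bsub>M\<^esub> x) = r \<odot>\<^bsub>N\<^esub> f x) \<and>
        (\<forall>n. f ` piece M n \<subseteq> piece N n)}"

text \<open>
  Injective objects of the category of graded \<open>R\<close>-modules. The test objects \<open>A\<close>, \<open>B\<close> have their
  elements in the same type as \<open>I\<close>: this type serves as the universe of the category.
\<close>

definition graded_injective :: "'r graded_ring \<Rightarrow> ('r, 'c) graded_module \<Rightarrow> bool" where
  "graded_injective R I \<longleftrightarrow>
     is_graded_module R I \<and>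
     (\<forall>(A :: ('r, 'c) graded_module) (B :: ('r, 'c) graded_module).
        \<forall>i\<in>graded_hom R A B. \<forall>g\<in>graded_hom R A I.
          is_graded_module R A \<and> is_graded_module R B \<and> inj_on i (carrier A) \<longrightarrow>
          (\<exists>h\<in>graded_hom R B I. \<forall>x\<in>carrier A. h (i x) = g x))"

definition graded_injective_resolution ::
  "'r graded_ring \<Rightarrow> ('r, 'm) graded_module \<Rightarrow>
   (nat \<Rightarrow> ('r, 'c) graded_module) \<Rightarrow> (nat \<Rightarrow> 'c \<Rightarrow> 'c) \<Rightarrow> ('m \<Rightarrow> 'c) \<Rightarrow> bool" where
  "graded_injective_resolution R M I \<delta> \<epsilon> \<longleftrightarrow>
     is_graded_module R M \<and>
     (\<forall>i. graded_injective R (I i)) \<and>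
     \<epsilon> \<in> graded_hom R M (I 0) \<and> inj_on \<epsilon> (carrier M) \<and>
     (\<forall>i. \<delta> i \<in> graded_hom R (I i) (I (Suc i))) \<and>
     \<epsilon> ` carrier M = {x \<in> carrier (I 0). \<delta> 0 x = \<zero>\<^bsub>I 1\<^esub>} \<and>
     (\<forall>i. \<delta> i ` carrier (I i) = {x \<in> carrier (I (Suc i)). \<delta> (Suc i) x = \<zero>\<^bsub>I (Suc (Suc i))\<^esub>})"

primrec ideal_power :: "('r, 'x) ring_scheme \<Rightarrow> 'r set \<Rightarrow> nat \<Rightarrow> 'r set" where
  "ideal_power R J 0 = carrier R"
| "ideal_power R J (Suc n) = ideal_prod R J (ideal_power R J n)"

definition torsion :: "'r graded_ring \<Rightarrow> 'r set \<Rightarrow> ('r, 'm) graded_module \<Rightarrow> 'm set" where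
  "torsion R J M =
     {x \<in> carrier M. \<exists>n. \<forall>r\<in>ideal_power R J n. r \<odot>\<^bsub>M\<^esub> x = \<zero>\<^bsub>M\<^esub>}"

text \<open>
  Local cohomology is the right derived functor of the torsion functor: \<open>H\<^sup>i\<close> is the quotient of
  the cocycles by the coboundaries of the complex obtained by applying \<open>torsion R J\<close> to a
  graded injective resolution \<open>(I, \<delta>)\<close>. Its component of degree \<open>n\<close> consists of the cosets of the
  homogeneous cocycles of degree \<open>n\<close>.
\<close>

definition cocycles ::
  "'r graded_ring \<Rightarrow> 'r set \<Rightarrow> (nat \<Rightarrow> ('r, 'c) graded_module) \<Rightarrow> (nat \<Rightarrow> 'c \<Rightarrow> 'c) \<Rightarrow> nat \<Rightarrow> 'c set" where
  "cocycles R J I \<delta> i = {x \<in> torsion R J (I i). \<delta> i x = \<zero>\<^bsub>I (Suc i)\<^esub>}"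

definition coboundaries ::
  "'r graded_ring \<Rightarrow> 'r set \<Rightarrow> (nat \<Rightarrow> ('r, 'c) graded_module) \<Rightarrow> (nat \<Rightarrow> 'c \<Rightarrow> 'c) \<Rightarrow> nat \<Rightarrow> 'c set" where
  "coboundaries R J I \<delta> i =
     (case i of 0 \<Rightarrow> {\<zero>\<^bsub>I 0\<^esub>} | Suc j \<Rightarrow> \<delta> j ` torsion R J (I j))"

definition local_cohomology_piece ::
  "'r graded_ring \<Rightarrow> 'r set \<Rightarrow> (nat \<Rightarrow> ('r, 'c) graded_module) \<Rightarrow> (nat \<Rightarrow> 'c \<Rightarrow> 'c) \<Rightarrow>
   nat \<Rightarrow> int \<Rightarrow> 'c set set" where
  "local_cohomology_piece R J I \<delta> i n =
     (\<lambda>x. coboundaries R J I \<delta> i +>\<^bsub>I i\<^esub> x) ` (cocycles R J I \<delta> i \<inter> piece (I i) n)"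

text \<open>
  The coboundaries are the zero element of the quotient. The supremum is taken in the extended
  reals, so that it is \<open>-\<infinity>\<close> if the cohomology vanishes.
\<close>

definition a_invariant ::
  "'r graded_ring \<Rightarrow> 'r set \<Rightarrow> (nat \<Rightarrow> ('r, 'c) graded_module) \<Rightarrow> (nat \<Rightarrow> 'c \<Rightarrow> 'c) \<Rightarrow> nat \<Rightarrow> ereal" where
  "a_invariant R J I \<delta> i =
     (SUP n\<in>{n. local_cohomology_piece R J I \<delta> i n \<noteq> {coboundaries R J I \<delta> i}}.
        ereal (real_of_int n))"

section \<open>Monoids and their semigroup rings\<close>

inductive_set generated_monoid :: "'a::monoid_add set \<Rightarrow> 'a set" for G where
  zero: "0 \<in> generated_monoid G"
| add: "x \<in> G \<Longrightarrow> u \<in> generated_monoid G \<Longrightarrow> x + u \<in> generated_monoid G"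

text \<open>
  The semigroup ring is the subring of \<open>K[\<nat>\<^sup>2]\<close> of elements with support in \<open>S\<close>,
  graded by \<open>(u\<^sub>1 + u\<^sub>2) / d\<close>.
\<close>

definition semigroup_ring ::
  "nat \<Rightarrow> (nat \<times> nat) set \<Rightarrow> ((nat \<times> nat) \<Rightarrow>\<^sub>0 'k::field) graded_ring" where
  "semigroup_ring d S =
     \<lparr>carrier = {f. Poly_Mapping.keys f \<subseteq> S}, mult = (*), one = 1, zero = 0, add = (+),
      ring_piece = (\<lambda>n. {f. Poly_Mapping.keys f \<subseteq> {u \<in> S. int (fst u + snd u) = n * int d}})\<rparr>"

definition max_hom_ideal ::
  "nat \<Rightarrow> (nat \<times> nat) set \<Rightarrow> ((nat \<times> nat) \<Rightarrow>\<^sub>0 'k::field) set" where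
  "max_hom_ideal d S =
     Idl\<^bsub>semigroup_ring d S\<^esub> ((\<lambda>u. Poly_Mapping.single u 1) ` (S - {0}))"

section \<open>Monomial curves\<close>

definition evec :: "nat \<Rightarrow> nat \<Rightarrow> nat \<times> nat" where
  "evec d h = (h, d - h)"

definition curve_monoid :: "nat \<Rightarrow> (nat \<Rightarrow> nat) \<Rightarrow> nat \<Rightarrow> (nat \<times> nat) set" where
  "curve_monoid k a d = generated_monoid (evec d ` a ` {0..k})"

definition A1 :: "nat \<Rightarrow> (nat \<Rightarrow> nat) \<Rightarrow> nat set" where
  "A1 k a = a ` {0..k}"

definition A2 :: "nat \<Rightarrow> (nat \<Rightarrow> nat) \<Rightarrow> nat \<Rightarrow> nat set" where
  "A2 k a d = (\<lambda>i. d - a i) ` {0..k}"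

definition omega :: "nat \<Rightarrow> nat set \<Rightarrow> nat \<Rightarrow> nat" where
  "omega d A j = (if j = d then 0 else (LEAST \<alpha>. \<alpha> \<in> generated_monoid A \<and> \<alpha> mod d = j mod d))"

definition delta :: "nat set \<Rightarrow> nat \<Rightarrow> nat" where
  "delta A n = (LEAST m. \<exists>x :: nat \<Rightarrow> nat.
     n = (\<Sum>b\<in>A - {0}. x b * b) \<and> m = (\<Sum>b\<in>A - {0}. x b))"

definition wvec :: "nat \<Rightarrow> (nat \<Rightarrow> nat) \<Rightarrow> nat \<Rightarrow> nat \<Rightarrow> nat \<times> nat" where
  "wvec k a d j = (omega d (A1 k a) j, omega d (A2 k a d) (d - j))"

definition wdeg :: "nat \<Rightarrow> nat \<times> nat \<Rightarrow> real" where
  "wdeg d u = real (fst u + snd u) / real d"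

definition delta1_w :: "nat \<Rightarrow> (nat \<Rightarrow> nat) \<Rightarrow> nat \<Rightarrow> nat \<Rightarrow> real" where
  "delta1_w k a d j = real (delta (A1 k a) (fst (wvec k a d j)))"

definition delta2_w :: "nat \<Rightarrow> (nat \<Rightarrow> nat) \<Rightarrow> nat \<Rightarrow> nat \<Rightarrow> real" where
  "delta2_w k a d j = real (delta (A2 k a d) (snd (wvec k a d j)))"

definition exceptional :: "nat \<Rightarrow> (nat \<Rightarrow> nat) \<Rightarrow> nat \<Rightarrow> nat set" where
  "exceptional k a d = {i. 1 \<le> i \<and> i \<le> d - 1 \<and> i \<notin> a ` {1..k - 1} \<and>
                  delta1_w k a d i > wdeg d (wvec k a d i)}"

end

theory Submission
  imports Defs
begin

text \<open>
  Let \<open>S' = {u. u\<^sub>1 \<in> \<langle>A\<^sub>1\<rangle>, u\<^sub>2 \<in> \<langle>A\<^sub>2\<rangle>, d dvd u\<^sub>1 + u\<^sub>2}\<close>. Then \<open>H\<^sup>1\<close> of \<open>K[S]\<close> is \<open>K[S'] / K[S]\<close>, so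
  its top degree is the largest degree of an element of \<open>S' - S\<close>. An element \<open>u\<close> of \<open>S'\<close> lies in \<open>S\<close> iff
  \<open>\<delta>\<^sub>1(u\<^sub>1) \<le> deg u\<close>, and equally iff \<open>\<delta>\<^sub>2(u\<^sub>2) \<le> deg u\<close>, and it has the form \<open>w\<^sub>j + x (d, 0) + y (0, d)\<close>.
  If \<open>u\<close> is not in \<open>S\<close>, then \<open>\<delta>\<^sub>1(w\<^sub>j) > deg w\<^sub>j + y\<close> and \<open>\<delta>\<^sub>2(w\<^sub>j) > deg w\<^sub>j + x\<close>; adding these gives (ii), and
  (iii) follows from \<open>a\<^sub>1 \<delta>\<^sub>1(n) \<le> n\<close> and \<open>(d - a\<^bsub>k-1\<^esub>) \<delta>\<^sub>2(n) \<le> n\<close>. For (i), \<open>w\<^sub>i + y (0, d)\<close> and \<open>w\<^sub>i + x (d, 0)\<close>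
  with \<open>y\<close>, \<open>x\<close> as large as possible are not in \<open>S\<close>.
\<close>

section \<open>Representations by generators\<close>

lemma generated_monoid_gen: "x \<in> G \<Longrightarrow> x \<in> generated_monoid G"
  using generated_monoid.add[OF _ generated_monoid.zero] by fastforce

lemma generated_monoid_plus:
  "u \<in> generated_monoid G \<Longrightarrow> v \<in> generated_monoid G \<Longrightarrow> u + v \<in> generated_monoid G"
  by (induction rule: generated_monoid.induct) (auto simp: add.assoc intro: generated_monoid.intros)

lemma generated_monoid_sum:
  fixes f :: "'b \<Rightarrow> 'a::comm_monoid_add"
  shows "(\<And>x. x \<in> X \<Longrightarrow> f x \<in> generated_monoid G) \<Longrightarrow> sum f X \<in> generated_monoid G"
  by (induction X rule: infinite_finite_induct)
    (auto intro: generated_monoid.zero generated_monoid_plus)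

lemma generated_monoid_mult:
  fixes x :: "'a::semiring_1"
  assumes "x \<in> generated_monoid G"
  shows "of_nat n * x \<in> generated_monoid G"
  by (induction n) (auto simp: algebra_simps intro: generated_monoid.zero generated_monoid_plus assms)

lemma generated_monoid_scale_pair:
  fixes u :: "nat \<times> nat"
  assumes "u \<in> generated_monoid G"
  shows "(n * fst u, n * snd u) \<in> generated_monoid G"
proof (induction n)
  case 0
  show ?case using generated_monoid.zero[of G] by (simp add: zero_prod_def)
next
  case (Suc n)
  have "(Suc n * fst u, Suc n * snd u) = u + (n * fst u, n * snd u)"
    by (cases u) simp
  then show ?case using generated_monoid_plus[OF assms Suc] by simp
qed

lemma generated_monoid_image:
  assumes "f 0 = 0" "\<And>x y. f (x + y) = f x + f y" "u \<in> generated_monoid G"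
  shows "f u \<in> generated_monoid (f ` G)"
  using assms(3) by induction (auto simp: assms intro: generated_monoid.intros)

text \<open>The relation minimised by \<open>delta\<close>, with the number \<open>m\<close> of
  summands kept as a parameter: representations add up, whereas minimal ones in general do
  not.\<close>

definition representable :: "nat set \<Rightarrow> nat \<Rightarrow> nat \<Rightarrow> bool" where
  "representable A n m \<longleftrightarrow>
     (\<exists>x :: nat \<Rightarrow> nat. n = (\<Sum>b\<in>A - {0}. x b * b) \<and> m = (\<Sum>b\<in>A - {0}. x b))"

lemma representable_0: "representable A 0 0"
  unfolding representable_def by (intro exI[of _ "\<lambda>_. 0"]) simp

lemma representable_gen:
  assumes "finite A" "b \<in> A" "b \<noteq> 0"
  shows "representable A b 1"
  unfolding representable_def
  by (intro exI[of _ "\<lambda>c. if c = b then 1 else 0"])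
    (use assms in \<open>auto simp: if_distrib[of "\<lambda>t. t * _"] cong: if_cong\<close>)

lemma representable_add:
  assumes "representable A n m" "representable A n' m'"
  shows "representable A (n + n') (m + m')"
proof -
  obtain x y where "n = (\<Sum>b\<in>A - {0}. x b * b)" "m = (\<Sum>b\<in>A - {0}. x b)"
    "n' = (\<Sum>b\<in>A - {0}. y b * b)" "m' = (\<Sum>b\<in>A - {0}. y b)"
    using assms unfolding representable_def by blast
  then show ?thesis unfolding representable_def
    by (intro exI[of _ "\<lambda>b. x b + y b"]) (simp add: sum.distrib algebra_simps)
qed

lemma representable_generated_monoid:
  assumes "representable A n m"
  shows "n \<in> generated_monoid A"
proof -
  obtain x where "n = (\<Sum>b\<in>A - {0}. x b * b)"
    using assms unfolding representable_def by blast
  moreover have "x b * b \<in> generated_monoid A" if "b \<in> A - {0}" for b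
    using generated_monoid_mult[of b A "x b"] generated_monoid_gen[of b A] that by simp
  ultimately show ?thesis by (simp only: generated_monoid_sum)
qed

lemma generated_monoid_representable:
  assumes "finite A" "n \<in> generated_monoid A"
  shows "\<exists>m. representable A n m"
  using assms(2)
proof induction
  case zero
  then show ?case using representable_0 by blast
next
  case (add b n)
  then obtain m where "representable A n m" by blast
  then show ?case
    using representable_add[OF representable_gen[OF assms(1) add(1)]] by (cases "b = 0") auto
qed

lemma delta_le: "representable A n m \<Longrightarrow> delta A n \<le> m"
  unfolding delta_def representable_def by (rule Least_le)

lemma representable_delta:
  assumes "finite A" "n \<in> generated_monoid A"
  shows "representable A n (delta A n)"
proof -
  obtain m where "representable A n m" using generated_monoid_representable[OF assms] by blast
  then show ?thesis unfolding representable_def delta_def by (rule LeastI)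
qed

text \<open>A shortest representation has \<open>delta A n\<close> summands, each at least
  \<open>c\<close>. With \<open>c\<close> the least positive element this becomes the degree
  estimate behind the floor bound.\<close>

lemma delta_mult_le:
  assumes "finite A" "n \<in> generated_monoid A" "\<And>b. b \<in> A - {0} \<Longrightarrow> c \<le> b"
  shows "c * delta A n \<le> n"
proof -
  obtain x where x: "n = (\<Sum>b\<in>A - {0}. x b * b)" "delta A n = (\<Sum>b\<in>A - {0}. x b)"
    using representable_delta[OF assms(1,2)] unfolding representable_def by blast
  show ?thesis unfolding x(2) sum_distrib_left
    by (subst x(1), intro sum_mono) (simp add: assms(3) mult.commute)
qed

section \<open>Gaps of a projective monomial curve\<close>

locale monomial_curve =
  fixes d :: nat and A :: "nat set"
  assumes A_le: "A \<subseteq> {..d}" and zero_A: "0 \<in> A" and d_A: "d \<in> A" and d_pos: "d > 0"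
begin

definition S :: "(nat \<times> nat) set" where "S = generated_monoid (evec d ` A)"

definition B :: "nat set" where "B = (\<lambda>b. d - b) ` A"

text \<open>A pair lies here iff some \<open>(0, N * d)\<close> and some \<open>(N * d, 0)\<close>
  each carry it into \<open>S\<close>. So this is the intersection of the two monoids obtained from
  \<open>S\<close> by inverting \<open>(0, d)\<close> and \<open>(d, 0)\<close>,
  respectively.\<close>

definition saturation :: "(nat \<times> nat) set" where
  "saturation = {u. fst u \<in> generated_monoid A \<and> snd u \<in> generated_monoid B \<and> d dvd fst u + snd u}"

lemma finite_A: "finite A"
  using A_le finite_subset by blast

text \<open>Reflecting \<open>b\<close> to \<open>d - b\<close> corresponds to exchanging the two
  coordinates. As the reflected set satisfies the same axioms, each fact about \<open>A\<close> and
  first coordinates also yields one about \<open>B\<close> and second coordinates.\<close>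

lemma dual: "monomial_curve d B"
proof
  show "0 \<in> B" unfolding B_def by (rule image_eqI[OF _ d_A]) simp
  show "d \<in> B" unfolding B_def by (rule image_eqI[OF _ zero_A]) simp
qed (use d_pos in \<open>auto simp: B_def\<close>)

lemma finite_B: "finite B"
  using finite_A by (simp add: B_def)

lemma dual_B: "monomial_curve.B d B = A"
proof -
  have "(\<lambda>b. d - (d - b)) ` A = id ` A" using A_le by (intro image_cong) auto
  then show ?thesis unfolding monomial_curve.B_def[OF dual] unfolding B_def by (simp add: image_image)
qed

section \<open>Membership in the monoid and the exchange of coordinates\<close>

lemma S_zero: "0 \<in> S"
  unfolding S_def by (rule generated_monoid.zero)

lemma S_plus: "u \<in> S \<Longrightarrow> v \<in> S \<Longrightarrow> u + v \<in> S"
  unfolding S_def by (rule generated_monoid_plus)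

lemma S_evec: "b \<in> A \<Longrightarrow> (n * b, n * (d - b)) \<in> S"
  unfolding S_def using generated_monoid_scale_pair[OF generated_monoid_gen, of "evec d b" "evec d ` A" n]
  by (simp add: evec_def)

lemma S_left: "(0, n * d) \<in> S" and S_right: "(n * d, 0) \<in> S"
  using S_evec[OF zero_A] S_evec[OF d_A] by simp_all

text \<open>The swap sends \<open>evec d b\<close> to \<open>evec d (d - b)\<close>. One inclusion
  suffices: applied to the dual curve it gives the converse.\<close>

lemma S_swap: "u \<in> S \<Longrightarrow> prod.swap u \<in> monomial_curve.S d B"
proof -
  assume "u \<in> S"
  then have "prod.swap u \<in> generated_monoid (prod.swap ` evec d ` A)"
    unfolding S_def by (intro generated_monoid_image) (auto simp: zero_prod_def plus_prod_def)
  moreover have "prod.swap ` evec d ` A = evec d ` B"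
    using A_le by (force simp: B_def evec_def image_image)
  ultimately show ?thesis by (simp add: monomial_curve.S_def[OF dual])
qed

lemma S_swap_iff: "prod.swap u \<in> monomial_curve.S d B \<longleftrightarrow> u \<in> S"
  using S_swap[of u] monomial_curve.S_swap[OF dual, of "prod.swap u"] by (auto simp only: dual_B swap_swap)

text \<open>An element of degree \<open>n\<close> is a sum of \<open>n\<close> generators. Those
  equal to \<open>(0, d)\<close> do not contribute to the first coordinate, so \<open>m\<close>
  counts the remaining ones and \<open>n - m\<close> the copies of \<open>(0, d)\<close>.\<close>

lemma S_iff_representable:
  "u \<in> S \<longleftrightarrow> (\<exists>n m. fst u + snd u = n * d \<and> m \<le> n \<and> representable A (fst u) m)"
proof
  assume "u \<in> S"
  then show "\<exists>n m. fst u + snd u = n * d \<and> m \<le> n \<and> representable A (fst u) m"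
    unfolding S_def
  proof induction
    case zero
    then show ?case using representable_0[of A] by (auto simp: zero_prod_def)
  next
    case (add g u)
    then obtain n m b where *: "fst u + snd u = n * d" "m \<le> n" "representable A (fst u) m"
      and b: "b \<in> A" "g = evec d b" by blast
    have d: "fst (g + u) + snd (g + u) = Suc n * d"
      using *(1) b A_le by (auto simp: evec_def)
    show ?case
    proof (cases "b = 0")
      case True
      then have "representable A (fst (g + u)) m" using * b by (simp add: evec_def)
      then show ?thesis using d *(2) le_SucI by blast
    next
      case False
      then have "representable A (fst (g + u)) (1 + m)"
        using * b representable_add[OF representable_gen[OF finite_A b(1)]] by (simp add: evec_def)
      then show ?thesis using d *(2) by (intro exI[of _ "Suc n"] exI[of _ "1 + m"]) simp
    qed
  qed
next
  assume "\<exists>n m. fst u + snd u = n * d \<and> m \<le> n \<and> representable A (fst u) m"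
  then obtain n m x where n: "fst u + snd u = n * d" "m \<le> n"
    and x: "fst u = (\<Sum>b\<in>A - {0}. x b * b)" "m = (\<Sum>b\<in>A - {0}. x b)"
    unfolding representable_def by blast
  \<comment> \<open>The representation is lifted to generators and padded with copies of
    \<open>(0, d)\<close> until the degree is \<open>n\<close>.\<close>
  let ?v = "(\<Sum>b\<in>A - {0}. (x b * b, x b * (d - b))) + (0, (n - m) * d)"
  have "?v \<in> S"
    by (intro S_plus S_left) (auto simp: S_def intro!: generated_monoid_sum S_evec[unfolded S_def])
  moreover have "fst ?v = fst u" by (simp add: x(1) fst_sum)
  moreover have "fst ?v + snd ?v = n * d"
  proof -
    have "fst ?v + snd ?v = (\<Sum>b\<in>A - {0}. x b * b + x b * (d - b)) + (n - m) * d"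
      by (simp add: fst_sum snd_sum sum.distrib)
    also have "(\<Sum>b\<in>A - {0}. x b * b + x b * (d - b)) = (\<Sum>b\<in>A - {0}. x b * d)"
      using A_le by (intro sum.cong) (auto simp: add_mult_distrib2[symmetric])
    also have "\<dots> + (n - m) * d = n * d"
      using n(2) by (simp add: x(2) sum_distrib_right[symmetric] add_mult_distrib[symmetric])
    finally show ?thesis .
  qed
  ultimately have "?v = u" using n(1) by (intro prod_eqI) auto
  with \<open>?v \<in> S\<close> show "u \<in> S" by simp
qed

lemma S_dvd: "u \<in> S \<Longrightarrow> d dvd fst u + snd u"
  by (auto simp: S_iff_representable)

lemma S_fst: "u \<in> S \<Longrightarrow> fst u \<in> generated_monoid A"
  unfolding S_iff_representable using representable_generated_monoid by blast

lemma S_snd: "u \<in> S \<Longrightarrow> snd u \<in> generated_monoid B"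
  using monomial_curve.S_fst[OF dual S_swap] by simp

text \<open>Among representations of length at most the degree, only the shortest matters. This is
  the test by which gaps are recognised.\<close>

lemma S_iff_delta:
  assumes "fst u \<in> generated_monoid A" "fst u + snd u = n * d"
  shows "u \<in> S \<longleftrightarrow> delta A (fst u) \<le> n"
proof
  assume "u \<in> S"
  then obtain n' m where "fst u + snd u = n' * d" "m \<le> n'" "representable A (fst u) m"
    unfolding S_iff_representable by blast
  then show "delta A (fst u) \<le> n"
    using delta_le assms(2) d_pos by fastforce
next
  assume "delta A (fst u) \<le> n"
  then show "u \<in> S"
    unfolding S_iff_representable using representable_delta[OF finite_A assms(1)] assms(2) by blast
qed

lemma S_iff_delta_dual:
  assumes "snd u \<in> generated_monoid B" "fst u + snd u = n * d"
  shows "u \<in> S \<longleftrightarrow> delta B (snd u) \<le> n"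
  using monomial_curve.S_iff_delta[OF dual, of "prod.swap u" n] assms
  by (simp add: S_swap_iff add.commute)

section \<open>Residue classes modulo \<open>d\<close> and the degrees of gaps\<close>

lemma generated_monoid_add_d: "n \<in> generated_monoid A \<Longrightarrow> n + x * d \<in> generated_monoid A"
  using generated_monoid_plus generated_monoid_mult[OF generated_monoid_gen[OF d_A], of x] by simp

lemma delta_add_d:
  assumes "n \<in> generated_monoid A"
  shows "delta A (n + x * d) \<le> delta A n + x"
proof (induction x)
  case (Suc x)
  have "delta A (n + x * d + d) \<le> delta A (n + x * d) + 1"
    using representable_delta[OF finite_A generated_monoid_add_d[OF assms]] d_pos
      representable_gen[OF finite_A d_A] by (intro delta_le representable_add) auto
  with Suc show ?case by (simp add: algebra_simps)
qed simp

text \<open>The element \<open>n\<close> shows that its residue class is met by the monoid, so that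
  the \<open>LEAST\<close> in \<open>omega\<close> is attained.\<close>

lemma omega_props:
  assumes "n \<in> generated_monoid A" "j < d" "n mod d = j"
  shows "omega d A j \<in> generated_monoid A" "omega d A j mod d = j" "omega d A j \<le> n"
    "\<exists>x. n = omega d A j + x * d"
proof -
  have *: "n \<in> generated_monoid A \<and> n mod d = j mod d" using assms by simp
  have o: "omega d A j = (LEAST \<alpha>. \<alpha> \<in> generated_monoid A \<and> \<alpha> mod d = j mod d)"
    using assms(2) by (simp add: omega_def)
  show "omega d A j \<in> generated_monoid A" "omega d A j mod d = j"
    using LeastI[of "\<lambda>\<alpha>. \<alpha> \<in> generated_monoid A \<and> \<alpha> mod d = j mod d" n] * assms(2) o by simp_all
  show "omega d A j \<le> n" unfolding o using * by (rule Least_le)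
  then show "\<exists>x. n = omega d A j + x * d"
    using \<open>omega d A j mod d = j\<close> assms(3)
    by (metis add_diff_inverse_nat dvd_def mod_eq_dvd_iff_nat mult.commute not_less)
qed

definition w :: "nat \<Rightarrow> nat \<times> nat" where "w j = (omega d A j, omega d B (d - j))"

text \<open>Since \<open>d\<close> divides the coordinate sum, the class \<open>j\<close> of the
  first coordinate forces the class \<open>d - j\<close> on the second. Both coordinates then exceed
  the minimal elements by multiples of \<open>d\<close>.\<close>

lemma w_props:
  assumes "0 < j" "j < d" "u \<in> saturation" "fst u mod d = j"
  shows "w j \<in> saturation" "\<exists>x y. u = (fst (w j) + x * d, snd (w j) + y * d)"
proof -
  have u: "fst u \<in> generated_monoid A" "snd u \<in> generated_monoid B" "d dvd fst u + snd u"
    using assms(3) by (auto simp: saturation_def)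
  have m: "snd u mod d = d - j"
  proof -
    have "(fst u + snd u) mod d = 0" using u(3) by simp
    then have "(j + snd u mod d) mod d = 0" using assms(4) mod_add_eq[of "fst u" d "snd u"] by simp
    then obtain k where k: "j + snd u mod d = d * k" by (auto simp: mod_eq_0_iff_dvd)
    have "snd u mod d < d" using d_pos by simp
    \<comment> \<open>Strictly between \<open>0\<close> and \<open>2 * d\<close> the only multiple
      of \<open>d\<close> is \<open>d\<close> itself.\<close>
    with k assms(1,2) have "d * k < d * 2" "d * k > 0" by linarith+
    then have "k = 1" by auto
    with k show ?thesis by simp
  qed
  have dj: "d - j < d" using assms by simp
  note A = omega_props[OF u(1) assms(2,4)]
  note Bp = monomial_curve.omega_props[OF dual u(2) dj m]
  have "(fst (w j) + snd (w j)) mod d = (j + (d - j)) mod d"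
    unfolding w_def fst_conv snd_conv by (metis A(2) Bp(2) mod_add_eq)
  then have "d dvd fst (w j) + snd (w j)" using assms(2) by (simp add: mod_eq_0_iff_dvd)
  then show "w j \<in> saturation" using A(1) Bp(1) by (simp add: saturation_def w_def)
  show "\<exists>x y. u = (fst (w j) + x * d, snd (w j) + y * d)"
    using A(4) Bp(4) by (metis w_def fst_conv snd_conv prod.collapse)
qed

text \<open>Let \<open>u\<close> be \<open>w j\<close> plus \<open>x\<close> copies of
  \<open>(d, 0)\<close> and \<open>y\<close> copies of \<open>(0, d)\<close>, so that
  \<open>n = q + x + y\<close>. Both delta tests fail for \<open>u\<close>, so \<open>n + 1\<close>
  is at most \<open>delta A (fst (w j)) + x\<close> and at most
  \<open>delta B (snd (w j)) + y\<close>. Subtracting \<open>x + y = n - q\<close> from the sum of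
  these gives the last claim.\<close>

lemma gap_upper:
  assumes u: "u \<in> saturation - S" and n: "fst u + snd u = n * d"
  obtains j q where "0 < j" "j < d" "j \<notin> A" "w j \<in> saturation" "fst (w j) + snd (w j) = q * d"
    "q < delta A (fst (w j))"
    "n + q + 2 \<le> delta A (fst (w j)) + delta B (snd (w j))"
proof -
  have u': "fst u \<in> generated_monoid A" "snd u \<in> generated_monoid B" "d dvd fst u + snd u" "u \<notin> S"
    using u by (auto simp: saturation_def)
  define j where "j = fst u mod d"
  \<comment> \<open>Otherwise \<open>u\<close> is a sum of multiples of \<open>(d, 0)\<close> and
    \<open>(0, d)\<close>, hence in \<open>S\<close>.\<close>
  have j0: "j \<noteq> 0"
  proof
    assume "j = 0"
    then obtain x where x: "fst u = x * d" unfolding j_def by (metis mod_0_imp_dvd dvd_def mult.commute)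
    with u'(3) obtain y where "snd u = y * d"
      by (metis dvd_add_right_iff dvd_triv_right dvd_def mult.commute)
    with x have "u = (x * d, 0) + (0, y * d)" by (cases u) simp
    then show False using S_plus[OF S_right S_left] u'(4) by metis
  qed
  have jd: "j < d" using d_pos by (simp add: j_def)
  have us: "u \<in> saturation" using u by simp
  note w = w_props[OF j0[unfolded neq0_conv] jd us j_def[symmetric]]
  note ws = w(1)
  obtain x y where xy: "u = (fst (w j) + x * d, snd (w j) + y * d)"
    using w(2) by blast
  obtain q where q: "fst (w j) + snd (w j) = q * d"
    using ws unfolding saturation_def by (auto simp: dvd_def mult.commute)
  have wA: "fst (w j) \<in> generated_monoid A" and wB: "snd (w j) \<in> generated_monoid B"
    using ws by (auto simp: saturation_def)
  have "n * d = (q + x + y) * d" using n q by (simp add: xy algebra_simps)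
  then have nq: "n = q + x + y" using d_pos by simp
  have 1: "n < delta A (fst (w j)) + x"
    using S_iff_delta[OF u'(1) n] u'(4) delta_add_d[OF wA, of x] by (simp add: xy)
  have 2: "n < delta B (snd (w j)) + y"
    using S_iff_delta_dual[OF u'(2) n] u'(4) monomial_curve.delta_add_d[OF dual wB, of y] by (simp add: xy)
  \<comment> \<open>For \<open>j\<close> in \<open>A\<close> the vector \<open>w j\<close> would be
    the generator \<open>(j, d - j)\<close>, of degree 1 and with delta value at most 1, against the
    first of the two inequalities.\<close>
  have "j \<notin> A"
  proof
    assume jA: "j \<in> A"
    have "fst (w j) \<le> j"
      using omega_props(3)[OF generated_monoid_gen[OF jA] jd] jd by (simp add: w_def)
    moreover have "snd (w j) \<le> d - j"
      using monomial_curve.omega_props(3)[OF dual, of "d - j" "d - j"] jA j0 jd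
      by (auto simp: w_def B_def intro: generated_monoid_gen)
    moreover have "fst (w j) mod d = j"
      using omega_props(2)[OF u'(1) jd j_def[symmetric]] by (simp add: w_def)
    ultimately have w: "fst (w j) = j" "fst (w j) + snd (w j) \<le> d"
      using jd mod_less_eq_dividend[of "fst (w j)" d] by auto
    have "q * d \<le> 1 * d" "q * d > 0" using w q j0 by linarith+
    then have "q \<le> 1" "q > 0" using d_pos by (simp_all only: mult_le_cancel2 nat_0_less_mult_iff)
    then have "q = 1" by simp
    then show False
      using 1 nq w(1) delta_le[OF representable_gen[OF finite_A jA j0]] by simp
  qed
  then show ?thesis using that[of j q] 1 2 nq j0 jd ws q by auto
qed

text \<open>Adding copies of \<open>(0, d)\<close> raises the degree and leaves
  \<open>delta A (fst u)\<close> unchanged, so the pair stays outside \<open>S\<close> as long as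
  its degree is below that value.\<close>

lemma gap_left:
  assumes "u \<in> saturation" "fst u + snd u = q * d" "q \<le> n" "n < delta A (fst u)"
  shows "\<exists>v\<in>saturation - S. fst v + snd v = n * d"
proof (intro bexI[of _ "(fst u, snd u + (n - q) * d)"])
  show *: "fst (fst u, snd u + (n - q) * d) + snd (fst u, snd u + (n - q) * d) = n * d"
    using assms(2,3) by (simp add: add.assoc[symmetric] add_mult_distrib[symmetric])
  have "(fst u, snd u + (n - q) * d) \<in> saturation"
    using assms(1) * monomial_curve.generated_monoid_add_d[OF dual]
    by (auto simp: saturation_def)
  then show "(fst u, snd u + (n - q) * d) \<in> saturation - S"
    using S_iff_delta[OF _ *] assms(4) by (auto simp: saturation_def)
qed

lemma saturation_swap: "prod.swap u \<in> monomial_curve.saturation d B \<longleftrightarrow> u \<in> saturation"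
  by (auto simp: saturation_def monomial_curve.saturation_def[OF dual] dual_B add.commute)

text \<open>The same construction on the dual curve, adding copies of \<open>(d, 0)\<close>.\<close>

lemma gap_right:
  assumes "u \<in> saturation" "fst u + snd u = q * d" "q \<le> n" "n < delta B (snd u)"
  shows "\<exists>v\<in>saturation - S. fst v + snd v = n * d"
proof -
  obtain v where "v \<in> monomial_curve.saturation d B - monomial_curve.S d B" "fst v + snd v = n * d"
    using monomial_curve.gap_left[OF dual, of "prod.swap u" q n] assms
    by (auto simp: saturation_swap add.commute)
  then show ?thesis
    using saturation_swap[of "prod.swap v"] S_swap_iff[of "prod.swap v"]
    by (intro bexI[of _ "prod.swap v"]) (auto simp: add.commute)
qed

text \<open>The residues modulo \<open>d\<close> of the elements of the generated monoid form a subgroup,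
  since \<open>(d - 1) * \<alpha>\<close> represents \<open>- \<alpha>\<close>.\<close>

lemma residue_attained:
  assumes "Gcd A = 1"
  shows "\<exists>\<alpha>\<in>generated_monoid A. \<alpha> mod d = j mod d"
proof -
  define H where "H = {n. \<exists>\<alpha>\<in>generated_monoid A. \<alpha> mod d = n mod d}"
  have H_add: "m + n \<in> H" if "m \<in> H" "n \<in> H" for m n
    using that unfolding H_def by (auto intro: generated_monoid_plus mod_add_cong)
  have H_mult: "n * m \<in> H" if "m \<in> H" for m n
    using that generated_monoid_mult[of _ A n] unfolding H_def by (auto intro: mod_mult_cong)
  have AH: "A \<subseteq> H" by (auto simp: H_def intro: generated_monoid_gen)
  define g where "g = (LEAST n. 0 < n \<and> n \<in> H)"
  have g: "0 < g" "g \<in> H"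
    using LeastI[of "\<lambda>n. 0 < n \<and> n \<in> H" d] AH d_A d_pos by (auto simp: g_def)
  have "g dvd h" if "h \<in> H" for h
  proof (rule ccontr)
    assume "\<not> g dvd h"
    then have "0 < h mod g" by (simp add: mod_greater_zero_iff_not_dvd)
    have "h mod g \<in> H"
    proof -
      \<comment> \<open>Division with remainder inside \<open>H\<close>: instead of subtracting
        \<open>h div g * g\<close>, \<open>d - 1\<close> copies of it are added, which agrees modulo
        \<open>d\<close>.\<close>
      have "h + (h div g * (d - 1)) * g \<in> H" using H_add[OF that H_mult[OF g(2)]] .
      moreover have "h + (h div g * (d - 1)) * g = h mod g + h div g * g * d"
      proof -
        have "h + (h div g * (d - 1)) * g = h mod g + (h div g * g + h div g * g * (d - 1))"
          using div_mult_mod_eq[of h g] by (simp add: ac_simps)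
        also have "\<dots> = h mod g + h div g * g * d" using d_pos by (cases d) auto
        finally show ?thesis .
      qed
      ultimately show ?thesis unfolding H_def by simp
    qed
    then have "g \<le> h mod g" unfolding g_def using \<open>0 < h mod g\<close> by (intro Least_le) (simp add: g_def)
    then show False using mod_less_divisor[OF g(1), of h] by linarith
  qed
  then have "g dvd Gcd A" using AH by (auto intro!: Gcd_greatest)
  then have "g = 1" using assms by simp
  then have "j \<in> H" using H_mult[OF g(2), of j] by simp
  then show ?thesis by (simp add: H_def)
qed

text \<open>One element of \<open>saturation\<close> with first coordinate in the class of
  \<open>j\<close> is enough. The gcd condition supplies the first coordinate, and a large degree
  puts the pair into \<open>S\<close>.\<close>

lemma w_saturation:
  assumes "Gcd A = 1" "0 < j" "j < d"
  shows "w j \<in> saturation"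
proof -
  obtain \<alpha> where a: "\<alpha> \<in> generated_monoid A" "\<alpha> mod d = j"
    using residue_attained[OF assms(1), of j] assms(3) by auto
  have le: "\<alpha> \<le> (\<alpha> + delta A \<alpha>) * d" using d_pos by (cases d) auto
  \<comment> \<open>The degree \<open>\<alpha> + delta A \<alpha>\<close> is large enough for the
    delta test, and its summand \<open>\<alpha>\<close> makes the truncated subtraction
    exact.\<close>
  define u where "u = (\<alpha>, (\<alpha> + delta A \<alpha>) * d - \<alpha>)"
  have "fst u + snd u = (\<alpha> + delta A \<alpha>) * d" using le by (simp add: u_def)
  then have "u \<in> S" using S_iff_delta[of u "\<alpha> + delta A \<alpha>"] a(1) by (simp add: u_def)
  then have "u \<in> saturation" using S_fst S_snd S_dvd by (simp add: saturation_def)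
  then show ?thesis using w_props(1)[OF assms(2,3), of u] a by (simp add: u_def)
qed

text \<open>By the pigeonhole principle, an element of large degree contains either many copies of
  \<open>(0, d)\<close> or many copies of some generator \<open>(b, d - b)\<close> with \<open>b > 0\<close>, and
  \<open>d * (b, d - b) = b * (d, 0) + (d - b) * (0, d)\<close>.\<close>

lemma saturation_absorbs:
  assumes "u \<in> saturation"
  shows "\<exists>M. \<forall>s\<in>S. M * d \<le> fst s + snd s \<longrightarrow> u + s \<in> S"
proof -
  have u: "fst u \<in> generated_monoid A" "snd u \<in> generated_monoid B" using assms by (auto simp: saturation_def)
  obtain n where n: "fst u + snd u = n * d"
    using assms by (auto simp: saturation_def dvd_def mult.commute)
  \<comment> \<open>\<open>N\<close> copies of \<open>(0, d)\<close> or of \<open>(d, 0)\<close>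
    raise the degree at least to the delta value of the coordinate that they leave
    unchanged.\<close>
  define N where "N = delta A (fst u) + delta B (snd u)"
  have uN: "u + (0, N * d) \<in> S" "u + (N * d, 0) \<in> S"
  proof -
    have "fst (u + (0, N * d)) + snd (u + (0, N * d)) = (n + N) * d"
      "fst (u + (N * d, 0)) + snd (u + (N * d, 0)) = (n + N) * d"
      using n by (simp_all add: algebra_simps)
    then show "u + (0, N * d) \<in> S" "u + (N * d, 0) \<in> S"
      using S_iff_delta[of "u + (0, N * d)" "n + N"] S_iff_delta_dual[of "u + (N * d, 0)" "n + N"] u
      by (simp_all add: N_def)
  qed
  \<comment> \<open>In such a degree there are at least \<open>N\<close> copies of
    \<open>(0, d)\<close>, or so many other generators that one of them occurs at least
    \<open>d * N\<close> times.\<close>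
  have "u + s \<in> S" if s: "s \<in> S" and le: "(N + card (A - {0}) * (d * N)) * d \<le> fst s + snd s" for s
  proof -
    obtain n m where nm: "fst s + snd s = n * d" "m \<le> n" "representable A (fst s) m"
      using s unfolding S_iff_representable by blast
    have le': "N + card (A - {0}) * (d * N) \<le> n" using le nm(1) d_pos by simp
    consider "n - m \<ge> N" | "m > card (A - {0}) * (d * N)" using le' by linarith
    then show ?thesis
    proof cases
      case 1
      have "N * d \<le> snd s"
      proof -
        have "fst s \<le> m * d"
        proof -
          obtain x where x: "fst s = (\<Sum>b\<in>A - {0}. x b * b)" "m = (\<Sum>b\<in>A - {0}. x b)"
            using nm(3) unfolding representable_def by blast
          show ?thesis unfolding x sum_distrib_right
            using A_le by (intro sum_mono mult_le_mono) auto
        qed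
        moreover have "(m + N) * d \<le> n * d" using 1 nm(2) by (intro mult_le_mono1) simp
        ultimately show ?thesis using nm(1) by (simp add: algebra_simps)
      qed
      \<comment> \<open>\<open>N\<close> copies of \<open>(0, d)\<close> move from \<open>s\<close>
        to \<open>u\<close>; the rest keeps its first coordinate and hence its
        representation.\<close>
      define t where "t = (fst s, snd s - N * d)"
      have "fst t + snd t = (n - N) * d"
        using nm(1) \<open>N * d \<le> snd s\<close> by (simp add: t_def diff_mult_distrib)
      moreover have "m \<le> n - N" using 1 nm(2) by simp
      moreover have "representable A (fst t) m" using nm(3) by (simp add: t_def)
      ultimately have "t \<in> S" unfolding S_iff_representable by blast
      moreover have "u + s = (u + (0, N * d)) + t"
        using \<open>N * d \<le> snd s\<close> by (cases u; cases s) (simp add: t_def)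
      ultimately show ?thesis using S_plus[OF uN(1)] by metis
    next
      case 2
      obtain x where x: "fst s = (\<Sum>b\<in>A - {0}. x b * b)" "m = (\<Sum>b\<in>A - {0}. x b)"
        using nm(3) unfolding representable_def by blast
      obtain b where b: "b \<in> A - {0}" "x b \<ge> d * N"
      proof (rule ccontr)
        assume "\<not> thesis"
        then have "\<And>b. b \<in> A - {0} \<Longrightarrow> x b \<le> d * N" using that by force
        then have "m \<le> card (A - {0}) * (d * N)"
          using sum_bounded_above[of "A - {0}" x "d * N"] by (simp add: x(2))
        then show False using 2 by simp
      qed
      define y where "y = (\<lambda>c. if c = b then x b - d * N else x c)"
      have split: "(\<Sum>c\<in>A - {0}. f c * x c) = f b * (d * N) + (\<Sum>c\<in>A - {0}. f c * y c)" for f :: "nat \<Rightarrow> nat"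
      proof -
        have f: "finite (A - {0})" using finite_A by simp
        have "(\<Sum>c\<in>A - {0} - {b}. f c * y c) = (\<Sum>c\<in>A - {0} - {b}. f c * x c)"
          by (intro sum.cong) (auto simp: y_def)
        moreover have "f b * x b = f b * (d * N) + f b * y b"
          using b(2) by (simp add: y_def add_mult_distrib2[symmetric])
        ultimately show ?thesis
          using sum.remove[OF f b(1), of "\<lambda>c. f c * x c"] sum.remove[OF f b(1), of "\<lambda>c. f c * y c"] by simp
      qed
      define m' where "m' = (\<Sum>c\<in>A - {0}. y c)"
      have m': "m = d * N + m'" using split[of "\<lambda>_. 1"] by (simp add: x(2) m'_def)
      have f': "fst s = b * (d * N) + (\<Sum>c\<in>A - {0}. y c * c)"
        using split[of "\<lambda>c. c"] by (simp add: x(1) mult.commute)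
      have bd: "b \<le> d" using b A_le by auto
      have sn: "(d - b) * (d * N) \<le> snd s"
      proof -
        have "(\<Sum>c\<in>A - {0}. y c * c) \<le> m' * d"
          unfolding m'_def sum_distrib_right using A_le by (intro sum_mono mult_le_mono) auto
        moreover have "(d * N + m') * d \<le> fst s + snd s" using nm(1,2) m' by simp
        moreover have "d * N * d = b * (d * N) + (d - b) * (d * N)"
          using bd by (simp add: add_mult_distrib[symmetric])
        ultimately show ?thesis using f' by (simp add: algebra_simps)
      qed
      define t where "t = (fst s - b * (d * N), snd s - (d - b) * (d * N))"
      have st: "s = t + (b * (d * N), (d - b) * (d * N))"
        using f' sn by (cases s) (simp add: t_def)
      have "fst t + snd t = (n - d * N) * d"
      proof -
        have "b * (d * N) + (d - b) * (d * N) = d * N * d"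
          using bd by (simp add: add_mult_distrib[symmetric])
        moreover have "fst s + snd s = fst t + snd t + (b * (d * N) + (d - b) * (d * N))"
          by (subst (1 2) st) simp
        ultimately show ?thesis using nm(1) by (simp add: diff_mult_distrib)
      qed
      moreover have "m' \<le> n - d * N" using nm(2) m' by simp
      moreover have "representable A (fst t) m'"
        unfolding representable_def using f' by (intro exI[of _ y]) (simp add: t_def m'_def)
      ultimately have tS: "t \<in> S" unfolding S_iff_representable by blast
      \<comment> \<open>The \<open>d * N\<close> copies of \<open>(b, d - b)\<close> split into
        multiples of \<open>(d, 0)\<close> and \<open>(0, d)\<close>. As \<open>b > 0\<close>, one
        portion \<open>(N * d, 0)\<close> is available for \<open>u\<close>.\<close>
      have "u + s = (u + (N * d, 0)) + (t + (((b - 1) * N * d, 0) + (0, ((d - b) * N) * d)))"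
      proof -
        have "b * (d * N) = N * d + (b - 1) * N * d" using b(1) by (cases b) auto
        then show ?thesis by (subst st) (cases u; cases t; simp add: ac_simps)
      qed
      then show ?thesis using S_plus[OF uN(2) S_plus[OF tS S_plus[OF S_right S_left]]] by metis
    qed
  qed
  then show ?thesis by blast
qed

end

section \<open>Graded modules\<close>

definition components :: "('r, 'm) graded_module \<Rightarrow> 'm \<Rightarrow> (int \<Rightarrow> 'm) \<Rightarrow> bool" where
  "components M x c \<longleftrightarrow> (\<forall>n. c n \<in> piece M n) \<and> finite {n. c n \<noteq> \<zero>\<^bsub>M\<^esub>} \<and>
     x = (\<Oplus>\<^bsub>M\<^esub>n\<in>{n. c n \<noteq> \<zero>\<^bsub>M\<^esub>}. c n)"

lemma is_graded_moduleD:
  assumes "is_graded_module R M"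
  shows "Module.module R M" "cring R" "abelian_group M"
    "additive_subgroup (piece M n) M"
    "\<lbrakk>r \<in> ring_piece R m; x \<in> piece M n\<rbrakk> \<Longrightarrow> r \<odot>\<^bsub>M\<^esub> x \<in> piece M (m + n)"
    "x \<in> carrier M \<Longrightarrow> \<exists>!c. components M x c"
  using assms by (auto simp: is_graded_module_def components_def Module.module_def)

lemma piece_carrier: "is_graded_module R M \<Longrightarrow> x \<in> piece M n \<Longrightarrow> x \<in> carrier M"
  using is_graded_moduleD(4) additive_subgroup.a_subset by blast

lemma piece_zero: "is_graded_module R M \<Longrightarrow> \<zero>\<^bsub>M\<^esub> \<in> piece M n"
  using is_graded_moduleD(4) additive_subgroup.zero_closed by blast

lemma graded_homD:
  assumes "f \<in> graded_hom R M N"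
  shows "x \<in> carrier M \<Longrightarrow> f x \<in> carrier N"
    "\<lbrakk>x \<in> carrier M; y \<in> carrier M\<rbrakk> \<Longrightarrow> f (x \<oplus>\<^bsub>M\<^esub> y) = f x \<oplus>\<^bsub>N\<^esub> f y"
    "\<lbrakk>r \<in> carrier R; x \<in> carrier M\<rbrakk> \<Longrightarrow> f (r \<odot>\<^bsub>M\<^esub> x) = r \<odot>\<^bsub>N\<^esub> f x"
    "x \<in> piece M n \<Longrightarrow> f x \<in> piece N n"
  using assms unfolding graded_hom_def by blast+

lemma hom_zero:
  assumes "f \<in> graded_hom R M N" "abelian_group M" "abelian_group N"
  shows "f \<zero>\<^bsub>M\<^esub> = \<zero>\<^bsub>N\<^esub>"
proof -
  interpret M: abelian_group M by fact
  interpret N: abelian_group N by fact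
  show ?thesis
    using graded_homD(1,2)[OF assms(1), of "\<zero>\<^bsub>M\<^esub>"] by (metis M.r_zero M.zero_closed N.add.r_cancel_one')
qed

lemma hom_minus:
  assumes "f \<in> graded_hom R M N" "abelian_group M" "abelian_group N"
    and "x \<in> carrier M" "y \<in> carrier M"
  shows "f (x \<ominus>\<^bsub>M\<^esub> y) = f x \<ominus>\<^bsub>N\<^esub> f y"
proof -
  interpret M: abelian_group M by fact
  interpret N: abelian_group N by fact
  note f = graded_homD(1,2)[OF assms(1)]
  have "f (\<ominus>\<^bsub>M\<^esub> y) \<oplus>\<^bsub>N\<^esub> f y = \<zero>\<^bsub>N\<^esub>"
    using hom_zero[OF assms(1-3)] f(2)[of "\<ominus>\<^bsub>M\<^esub> y" y] assms(5) by (simp add: M.l_neg)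
  then have "\<ominus>\<^bsub>N\<^esub> f y = f (\<ominus>\<^bsub>M\<^esub> y)"
    using f(1) assms(5) by (intro N.minus_equality) auto
  then show ?thesis using f(2) assms(4,5) by (simp add: a_minus_def)
qed

lemma hom_finsum:
  assumes "f \<in> graded_hom R M N" "abelian_group M" "abelian_group N"
    and "finite F" "c \<in> F \<rightarrow> carrier M"
  shows "f (finsum M c F) = finsum N (\<lambda>n. f (c n)) F"
proof -
  interpret M: abelian_group M by fact
  interpret N: abelian_group N by fact
  note f = graded_homD(1,2)[OF assms(1)]
  show ?thesis using assms(4,5)
  proof induction
    case empty
    show ?case using hom_zero[OF assms(1-3)] by simp
  next
    case (insert n F)
    then have "c \<in> F \<rightarrow> carrier M" "c n \<in> carrier M" by auto
    moreover have "(\<lambda>n. f (c n)) \<in> F \<rightarrow> carrier N" "f (c n) \<in> carrier N"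
      using insert.prems f(1) by auto
    ultimately show ?case using insert.hyps insert.IH f(2) by (simp add: M.finsum_insert N.finsum_insert)
  qed
qed

text \<open>Moves homogeneous decompositions between a module and a submodule, whose sums are formed
  in different records.\<close>

lemma finsum_sub:
  assumes "abelian_group M" "abelian_group N" "carrier N \<subseteq> carrier M" "add N = add M"
    "zero N = zero M" "finite F" "c \<in> F \<rightarrow> carrier N"
  shows "finsum N c F = finsum M c F"
proof -
  interpret M: abelian_group M by fact
  interpret N: abelian_group N by fact
  show ?thesis using assms(6,7)
  proof induction
    case empty
    show ?case using assms(5) by simp
  next
    case (insert n F)
    then have "c \<in> F \<rightarrow> carrier N" "c n \<in> carrier N" by auto
    moreover from this have "c \<in> F \<rightarrow> carrier M" "c n \<in> carrier M" using assms(3) by auto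
    ultimately show ?case using insert.hyps insert.IH assms(4) by (simp add: M.finsum_insert N.finsum_insert)
  qed
qed

text \<open>A map of degree 0 carries a decomposition to a decomposition. Some components may become
  zero, so the support can only shrink.\<close>

lemma components_hom:
  assumes "is_graded_module R M" "is_graded_module R N" "f \<in> graded_hom R M N" "components M x c"
  shows "components N (f x) (\<lambda>n. f (c n))"
proof -
  note M = is_graded_moduleD(3)[OF assms(1)] and N = is_graded_moduleD(3)[OF assms(2)]
  interpret N: abelian_group N by fact
  let ?F = "{n. c n \<noteq> \<zero>\<^bsub>M\<^esub>}"
  have c: "\<And>n. c n \<in> piece M n" "finite ?F" "x = finsum M c ?F"
    using assms(4) by (auto simp: components_def)
  have cc: "\<And>n. c n \<in> carrier M" using c(1) piece_carrier[OF assms(1)] by blast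
  have sub: "{n. f (c n) \<noteq> \<zero>\<^bsub>N\<^esub>} \<subseteq> ?F" using hom_zero[OF assms(3) M N] by auto
  have "f x = finsum N (\<lambda>n. f (c n)) ?F"
    unfolding c(3) using c(2) cc by (intro hom_finsum[OF assms(3) M N]) auto
  also have "\<dots> = finsum N (\<lambda>n. f (c n)) {n. f (c n) \<noteq> \<zero>\<^bsub>N\<^esub>}"
    using sub c(2) graded_homD(1)[OF assms(3) cc]
    by (intro N.add.finprod_mono_neutral_cong_right) auto
  finally show ?thesis
    using graded_homD(4)[OF assms(3) c(1)] finite_subset[OF sub c(2)] by (simp add: components_def)
qed

lemma components_homogeneous:
  assumes "is_graded_module R M" "x \<in> piece M n"
  shows "components M x (\<lambda>m. if m = n then x else \<zero>\<^bsub>M\<^esub>)"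
proof -
  interpret M: abelian_group M using is_graded_moduleD(3)[OF assms(1)] .
  let ?c = "\<lambda>m. if m = n then x else \<zero>\<^bsub>M\<^esub>"
  have x: "x \<in> carrier M" using piece_carrier[OF assms] .
  have "{m. ?c m \<noteq> \<zero>\<^bsub>M\<^esub>} = (if x = \<zero>\<^bsub>M\<^esub> then {} else {n})" by auto
  then show ?thesis using x assms piece_zero[OF assms(1)] by (auto simp: components_def)
qed

text \<open>The component of \<open>x\<close> in degree \<open>n\<close> serves: by uniqueness of
  the decomposition of \<open>f x\<close>, its image is all of \<open>f x\<close>.\<close>

lemma homogeneous_preimage:
  assumes "is_graded_module R M" "is_graded_module R N" "f \<in> graded_hom R M N"
    and "x \<in> carrier M" "f x \<in> piece N n"
  obtains x' where "x' \<in> piece M n" "f x' = f x"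
proof -
  obtain c where c: "components M x c" using is_graded_moduleD(6)[OF assms(1,4)] by blast
  have "(\<lambda>m. f (c m)) = (\<lambda>m. if m = n then f x else \<zero>\<^bsub>N\<^esub>)"
    using is_graded_moduleD(6)[OF assms(2) graded_homD(1)[OF assms(3,4)]]
      components_hom[OF assms(1-3) c] components_homogeneous[OF assms(2,5)] by blast
  from fun_cong[OF this, of n] have "f (c n) = f x" by simp
  moreover have "c n \<in> piece M n" using c by (simp add: components_def)
  ultimately show ?thesis using that by blast
qed

text \<open>Degree \<open>j - n\<close> in \<open>M\<close> becomes degree \<open>j\<close>, so that
  multiplication by a monomial of degree \<open>n\<close> turns into a homomorphism of degree
  0.\<close>

definition shifted_submodule :: "('r, 'm) graded_module \<Rightarrow> 'm set \<Rightarrow> int \<Rightarrow> ('r, 'm) graded_module" where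
  "shifted_submodule M C n = M\<lparr>carrier := C, piece := (\<lambda>j. C \<inter> piece M (j - n))\<rparr>"

lemma shifted_submodule_simps [simp]:
  "carrier (shifted_submodule M C n) = C" "add (shifted_submodule M C n) = add M"
  "zero (shifted_submodule M C n) = zero M" "smult (shifted_submodule M C n) = smult M"
  "piece (shifted_submodule M C n) j = C \<inter> piece M (j - n)"
  by (simp_all add: shifted_submodule_def)

text \<open>Closure under components lets the decompositions of \<open>M\<close> restrict to
  \<open>C\<close>; the shift only reindexes them.\<close>

lemma shifted_submodule_graded:
  assumes M: "is_graded_module R M" and R: "\<And>m. ring_piece R m \<subseteq> carrier R"
    and C: "C \<subseteq> carrier M" "\<zero>\<^bsub>M\<^esub> \<in> C"
    and add: "\<And>x y. x \<in> C \<Longrightarrow> y \<in> C \<Longrightarrow> x \<oplus>\<^bsub>M\<^esub> y \<in> C"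
    and smult: "\<And>r x. r \<in> carrier R \<Longrightarrow> x \<in> C \<Longrightarrow> r \<odot>\<^bsub>M\<^esub> x \<in> C"
    and comp: "\<And>x c j. x \<in> C \<Longrightarrow> components M x c \<Longrightarrow> c j \<in> C"
  shows "is_graded_module R (shifted_submodule M C n)" (is "is_graded_module R ?N")
proof -
  interpret M: Module.module R M using is_graded_moduleD(1)[OF M] .
  \<comment> \<open>Closure under negation comes from multiplication by \<open>-1\<close>.\<close>
  have neg: "\<ominus>\<^bsub>M\<^esub> x \<in> C" if "x \<in> C" for x
  proof -
    have "(\<ominus>\<^bsub>R\<^esub> \<one>\<^bsub>R\<^esub>) \<odot>\<^bsub>M\<^esub> x \<in> C" using smult that by simp
    then show ?thesis using that C(1) by (simp add: M.smult_l_minus subset_iff)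
  qed
  have ag: "abelian_group ?N"
  proof (rule abelian_groupI, goal_cases)
    case (6 x)
    then show ?case using neg[of x] C(1) by (intro bexI[of _ "\<ominus>\<^bsub>M\<^esub> x"]) (auto simp: M.M.l_neg)
  qed (use add C in \<open>auto simp: M.M.a_ac subset_iff\<close>)
  interpret N: abelian_group ?N by fact
  have neg_eq: "\<ominus>\<^bsub>?N\<^esub> x = \<ominus>\<^bsub>M\<^esub> x" if "x \<in> C" for x
    using that neg[OF that] C(1) by (intro N.minus_equality) (auto simp: M.M.l_neg)
  have mod: "Module.module R ?N"
    by (rule moduleI) (use smult C(1) in \<open>auto simp: M.R.is_cring ag M.smult_l_distr M.smult_r_distr M.smult_assoc1 subset_iff\<close>)
  have sub: "additive_subgroup (piece ?N j) ?N" for j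
  proof (rule additive_subgroupI, rule N.add.subgroupI, goal_cases)
    case 2
    then show ?case using C(2) piece_zero[OF M] by auto
  next
    case (3 x)
    then show ?case
      using neg_eq[of x] neg[of x] additive_subgroup.a_inv_closed[OF is_graded_moduleD(4)[OF M]] M.M.abelian_group_axioms
      by (simp add: a_inv_def[symmetric])
  next
    case (4 x y)
    then show ?case using add additive_subgroup.a_closed[OF is_graded_moduleD(4)[OF M]] by simp
  qed auto
  have trans: "components ?N x c \<longleftrightarrow> components M x (\<lambda>j. c (j + n)) \<and> (\<forall>j. c j \<in> C)" for x c
  proof (cases "\<forall>j. c j \<in> C")
    case True
    have eq: "{j. c j \<noteq> \<zero>\<^bsub>M\<^esub>} = (\<lambda>j. j + n) ` {j. c (j + n) \<noteq> \<zero>\<^bsub>M\<^esub>}" (is "?F = _ ` ?G")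
      by (force simp: image_iff intro: exI[of _ "_ - n"])
    have fin: "finite ?F \<longleftrightarrow> finite ?G" unfolding eq by (intro finite_image_iff) (simp add: inj_on_def)
    have pc: "(\<forall>j. c j \<in> piece M (j - n)) \<longleftrightarrow> (\<forall>j. c (j + n) \<in> piece M j)"
      by (metis add_diff_cancel diff_add_cancel)
    have "finsum ?N c ?F = finsum M (\<lambda>j. c (j + n)) ?G" if "finite ?F"
    proof -
      have "finsum ?N c ?F = finsum M c ?F"
        using True C(1) that by (intro finsum_sub[OF M.M.abelian_group_axioms ag]) auto
      also have "\<dots> = finsum M (\<lambda>j. c (j + n)) ?G" unfolding eq
        using True C(1) by (subst M.M.finsum_reindex) (auto simp: inj_on_def)
      finally show ?thesis .
    qed
    then show ?thesis using True fin pc by (auto simp: components_def)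
  qed (auto simp: components_def)
  have "\<exists>!c. components ?N x c" if x: "x \<in> C" for x
  proof -
    obtain e where e: "components M x e" and u: "\<And>e'. components M x e' \<Longrightarrow> e' = e"
      using is_graded_moduleD(6)[OF M, of x] x C(1) by blast
    show ?thesis
    proof (rule ex1I)
      show "components ?N x (\<lambda>j. e (j - n))" using e comp[OF x e] by (simp add: trans)
    next
      fix c assume "components ?N x c"
      then have "(\<lambda>j. c (j + n)) = e" using u by (simp add: trans)
      then show "c = (\<lambda>j. e (j - n))" by force
    qed
  qed
  moreover have "r \<odot>\<^bsub>M\<^esub> x \<in> piece ?N (m + j)"
    if "r \<in> ring_piece R m" "x \<in> piece ?N j" for r x m j
    using that subsetD[OF R that(1)] smult[of r x] is_graded_moduleD(5)[OF M that(1), of x "j - n"] by (simp add: algebra_simps)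
  ultimately show ?thesis
    using mod sub unfolding is_graded_module_def components_def[symmetric] by (auto simp del: Int_iff)
qed

section \<open>Multiplication by monomials\<close>

lemma lookup_single_mult_shift:
  fixes f :: "'a::cancel_comm_monoid_add \<Rightarrow>\<^sub>0 'b::comm_semiring_1"
  shows "Poly_Mapping.lookup (Poly_Mapping.single s 1 * f) (s + u) = Poly_Mapping.lookup f u"
  by (simp add: lookup_mult lookup_single when_mult)

lemma keys_single_mult:
  fixes f :: "'a::cancel_comm_monoid_add \<Rightarrow>\<^sub>0 'b::comm_semiring_1"
  shows "Poly_Mapping.keys (Poly_Mapping.single s 1 * f) = (+) s ` Poly_Mapping.keys f"
proof
  show "Poly_Mapping.keys (Poly_Mapping.single s 1 * f) \<subseteq> (+) s ` Poly_Mapping.keys f"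
    using keys_mult[of "Poly_Mapping.single s 1" f] by fastforce
qed (auto simp: in_keys_iff lookup_single_mult_shift)

text \<open>Multiplication by a monomial translates supports injectively and preserves
  coefficients.\<close>

lemma single_mult_cancel:
  fixes f g :: "'a::cancel_comm_monoid_add \<Rightarrow>\<^sub>0 'b::comm_semiring_1"
  assumes "Poly_Mapping.single s 1 * f = Poly_Mapping.single s 1 * g"
  shows "f = g"
  by (rule poly_mapping_eqI) (metis assms lookup_single_mult_shift)

lemma single_mult_factor:
  fixes f :: "'a::cancel_comm_monoid_add \<Rightarrow>\<^sub>0 'b::comm_semiring_1"
  assumes "Poly_Mapping.keys f \<subseteq> (+) s ` T"
  obtains F where "Poly_Mapping.keys F \<subseteq> T" "f = Poly_Mapping.single s 1 * F"
proof
  let ?F = "Poly_Mapping.map_key ((+) s) f"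
  have inj: "inj ((+) s)" by simp
  show "Poly_Mapping.keys ?F \<subseteq> T"
    using assms by (auto simp: keys_map_key)
  show "f = Poly_Mapping.single s 1 * ?F"
  proof (rule poly_mapping_eqI)
    fix v
    show "Poly_Mapping.lookup f v = Poly_Mapping.lookup (Poly_Mapping.single s 1 * ?F) v"
    proof (cases "v \<in> range ((+) s)")
      case True
      then show ?thesis by (auto simp: lookup_single_mult_shift map_key.rep_eq inj)
    next
      case False
      then have "v \<notin> Poly_Mapping.keys f" "v \<notin> Poly_Mapping.keys (Poly_Mapping.single s 1 * ?F)"
        using assms by (auto simp: keys_single_mult)
      then show ?thesis by (simp add: in_keys_iff)
    qed
  qed
qed

section \<open>First local cohomology of the semigroup ring\<close>

lemma semigroup_ring_simps [simp]:
  "carrier (semigroup_ring d S) = {f. Poly_Mapping.keys f \<subseteq> S}" "mult (semigroup_ring d S) = (*)"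
  "one (semigroup_ring d S) = 1" "zero (semigroup_ring d S) = 0" "add (semigroup_ring d S) = (+)"
  "ring_piece (semigroup_ring d S) n =
     {f. Poly_Mapping.keys f \<subseteq> {u \<in> S. int (fst u + snd u) = n * int d}}"
  by (simp_all add: semigroup_ring_def)

lemma self_module_simps [simp]:
  "carrier (self_module R) = carrier R" "add (self_module R) = add R" "zero (self_module R) = zero R"
  "smult (self_module R) = mult R" "piece (self_module R) = ring_piece R"
  by (simp_all add: self_module_def)

lemma (in cring) ideal_power_ideal:
  assumes "ideal J R"
  shows "ideal (ideal_power R J n) R"
  by (induction n) (simp_all add: oneideal ideal_prod_is_ideal assms)

lemma (in cring) ideal_power_antimono:
  assumes "ideal J R" "m \<le> n"
  shows "ideal_power R J n \<subseteq> ideal_power R J m"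
  using assms(2)
proof (induction rule: dec_induct)
  case (step n)
  then show ?case
    using ideal_prod_inter[OF assms(1) ideal_power_ideal[OF assms(1)], of n] by auto
qed simp

lemma image_eq_singleton_iff: "z \<in> X \<Longrightarrow> f ` X = {c} \<longleftrightarrow> (\<forall>x\<in>X. f x = c)"
  by (auto simp: image_iff set_eq_iff)

locale resolved_curve = monomial_curve d A for d A +
  fixes R :: "((nat \<times> nat) \<Rightarrow>\<^sub>0 'k::field) graded_ring"
    and I :: "nat \<Rightarrow> ((nat \<times> nat) \<Rightarrow>\<^sub>0 'k, 'c) graded_module"
    and \<delta> :: "nat \<Rightarrow> 'c \<Rightarrow> 'c" and \<epsilon> :: "((nat \<times> nat) \<Rightarrow>\<^sub>0 'k) \<Rightarrow> 'c"
  assumes R_def: "R = semigroup_ring d S"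
    and resolution: "graded_injective_resolution R (self_module R) I \<delta> \<epsilon>"
begin

lemma R_simps [simp]:
  "carrier R = {f. Poly_Mapping.keys f \<subseteq> S}" "mult R = (*)" "one R = 1" "zero R = 0" "add R = (+)"
  "ring_piece R n = {f. Poly_Mapping.keys f \<subseteq> {u \<in> S. int (fst u + snd u) = n * int d}}"
  by (simp_all add: R_def)

abbreviation \<mm> where "\<mm> \<equiv> max_hom_ideal d S :: ((nat \<times> nat) \<Rightarrow>\<^sub>0 'k) set"

abbreviation monomial :: "nat \<times> nat \<Rightarrow> (nat \<times> nat) \<Rightarrow>\<^sub>0 'k" where
  "monomial u \<equiv> Poly_Mapping.single u 1"

lemma self_graded: "is_graded_module R (self_module R)"
  and I_injective: "graded_injective R (I i)"
  and \<epsilon>_hom: "\<epsilon> \<in> graded_hom R (self_module R) (I 0)"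
  and \<epsilon>_inj: "inj_on \<epsilon> (carrier R)"
  and \<delta>_hom: "\<delta> i \<in> graded_hom R (I i) (I (Suc i))"
  and exact_0: "\<epsilon> ` carrier R = {x \<in> carrier (I 0). \<delta> 0 x = \<zero>\<^bsub>I 1\<^esub>}"
  and exact: "\<delta> i ` carrier (I i) = {x \<in> carrier (I (Suc i)). \<delta> (Suc i) x = \<zero>\<^bsub>I (Suc (Suc i))\<^esub>}"
  using resolution unfolding graded_injective_resolution_def by (auto simp del: R_simps)

lemma I_graded: "is_graded_module R (I i)"
  using I_injective by (auto simp: graded_injective_def)

lemma I_group: "abelian_group (I i)" and self_group: "abelian_group (self_module R)"
  using is_graded_moduleD(3) I_graded self_graded by blast+

sublocale R: cring R
  using is_graded_moduleD(2)[OF self_graded] .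

lemma module_I: "Module.module R (I i)"
  using is_graded_moduleD(1)[OF I_graded] .

section \<open>Powers of the maximal homogeneous ideal\<close>

lemma mm_ideal: "ideal \<mm> R"
  unfolding max_hom_ideal_def R_def[symmetric] by (rule R.genideal_ideal) auto

lemma monomial_in_mm: "s \<in> S \<Longrightarrow> s \<noteq> 0 \<Longrightarrow> monomial s \<in> \<mm>"
  unfolding max_hom_ideal_def R_def[symmetric]
  by (rule subsetD[OF R.genideal_self]) auto

lemma monomial_in_ideal_power:
  assumes "(x, y) \<in> S" "(x, y) \<noteq> 0"
  shows "monomial (n * x, n * y) \<in> ideal_power R \<mm> n"
proof (induction n)
  case 0
  show ?case using S_zero by (simp add: zero_prod_def)
next
  case (Suc n)
  have "monomial (Suc n * x, Suc n * y) = monomial (x, y) \<otimes>\<^bsub>R\<^esub> monomial (n * x, n * y)"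
    by (simp add: mult_single)
  then show ?case using ideal_prod.prod[OF monomial_in_mm[OF assms] Suc, of R] by simp
qed

text \<open>Powers of the two extremal generators. Each changes a single coordinate, which later
  allows supports to be compared coordinate by coordinate.\<close>

lemma monomial_left: "monomial (0, n * d) \<in> ideal_power R \<mm> n"
  and monomial_right: "monomial (n * d, 0) \<in> ideal_power R \<mm> n"
  using monomial_in_ideal_power[of 0 d n] monomial_in_ideal_power[of d 0 n] S_left[of 1] S_right[of 1] d_pos
  by (simp_all add: zero_prod_def)

definition high_degree :: "nat \<Rightarrow> ((nat \<times> nat) \<Rightarrow>\<^sub>0 'k) set" where
  "high_degree n = {f. Poly_Mapping.keys f \<subseteq> {s \<in> S. n * d \<le> fst s + snd s}}"

lemma high_degree_mult:
  assumes "f \<in> high_degree m" "g \<in> high_degree n"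
  shows "f * g \<in> high_degree (m + n)"
proof -
  have "s + t \<in> S \<and> (m + n) * d \<le> fst (s + t) + snd (s + t)"
    if "s \<in> Poly_Mapping.keys f" "t \<in> Poly_Mapping.keys g" for s t
    using that assms S_plus[of s t] add_mono[of "m * d" "fst s + snd s" "n * d" "fst t + snd t"]
    by (fastforce simp: high_degree_def algebra_simps)
  then show ?thesis using keys_mult[of f g] by (fastforce simp: high_degree_def)
qed

lemma high_degree_ideal: "ideal (high_degree n) R"
proof (rule idealI)
  \<comment> \<open>Closure under multiplication by ring elements becomes a case of
    \<open>high_degree_mult\<close>.\<close>
  have carrier: "carrier R = high_degree 0" by (auto simp: high_degree_def)
  show "subgroup (high_degree n) (add_monoid R)"
  proof (rule R.add.subgroupI, goal_cases)
    case 1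
    show ?case by (auto simp: high_degree_def)
  next
    case 2
    have "0 \<in> high_degree n" by (simp add: high_degree_def)
    then show ?case by auto
  next
    case (3 f)
    have "\<ominus>\<^bsub>R\<^esub> f = - f"
      using 3 by (intro R.minus_equality) (auto simp: high_degree_def)
    then show ?case using 3 by (simp add: high_degree_def a_inv_def[symmetric])
  next
    case (4 f g)
    then show ?case using keys_add[of f g] by (auto simp: high_degree_def)
  qed
  fix f r
  assume "f \<in> high_degree n" "r \<in> carrier R"
  then have "r * f \<in> high_degree n"
    using high_degree_mult[of r 0 f n] unfolding carrier by simp
  then show "r \<otimes>\<^bsub>R\<^esub> f \<in> high_degree n" "f \<otimes>\<^bsub>R\<^esub> r \<in> high_degree n"
    by (simp_all add: mult.commute)
qed (rule R.ring_axioms)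

lemma mm_high_degree: "\<mm> \<subseteq> high_degree 1"
  unfolding max_hom_ideal_def R_def[symmetric]
proof (rule R.genideal_minimal[OF high_degree_ideal])
  show "monomial ` (S - {0}) \<subseteq> high_degree 1"
  proof (clarsimp simp: high_degree_def)
    fix x y assume *: "(x, y) \<in> S" "(x, y) \<noteq> 0"
    then have "d dvd x + y" "x + y > 0" using S_dvd[OF *(1)] by (auto simp: zero_prod_def)
    then show "d \<le> x + y" by (rule dvd_imp_le)
  qed
qed

text \<open>Each factor from \<open>\<mm>\<close> contributes degree at least 1. Hence an ideal
  containing everything of large degree contains a power of \<open>\<mm>\<close>.\<close>

lemma ideal_power_high_degree: "ideal_power R \<mm> n \<subseteq> high_degree n"
proof (induction n)
  case 0
  show ?case by (auto simp: high_degree_def)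
next
  case (Suc n)
  show ?case
  proof
    fix f assume "f \<in> ideal_power R \<mm> (Suc n)"
    then have "f \<in> ideal_prod R \<mm> (ideal_power R \<mm> n)" by simp
    then show "f \<in> high_degree (Suc n)"
    proof induction
      case (prod i j)
      then show ?case using high_degree_mult[of i 1 j n] mm_high_degree Suc by auto
    next
      case (sum f g)
      then show ?case using keys_add[of f g] by (auto simp: high_degree_def)
    qed
  qed
qed

section \<open>Homogeneous components and the embedding \<open>\<epsilon>\<close>\<close>

lemma finsum_self:
  assumes "finite F" "c \<in> F \<rightarrow> carrier R"
  shows "finsum (self_module R) c F = sum c F"
proof -
  interpret M: abelian_group "self_module R" by (rule self_group)
  show ?thesis using assms
  proof induction
    case (insert n F)
    then have "c \<in> F \<rightarrow> carrier (self_module R)" "c n \<in> carrier (self_module R)" by auto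
    then show ?case using insert by (simp add: M.finsum_insert)
  qed simp
qed

text \<open>Components of different degrees have disjoint supports, so nothing cancels in their sum.
  Ideals given by a condition on supports are therefore homogeneous.\<close>

lemma components_self_keys:
  assumes "components (self_module R) f c"
  shows "Poly_Mapping.keys (c n) \<subseteq> Poly_Mapping.keys f"
proof
  fix u assume u: "u \<in> Poly_Mapping.keys (c n)"
  have c: "\<And>m. Poly_Mapping.keys (c m) \<subseteq> {u \<in> S. int (fst u + snd u) = m * int d}"
    "finite {m. c m \<noteq> 0}" "f = finsum (self_module R) c {m. c m \<noteq> 0}"
    using assms by (auto simp: components_def)
  have "f = (\<Sum>m | c m \<noteq> 0. c m)"
    using finsum_self[OF c(2), of c] c(1,3) by fastforce
  then have "Poly_Mapping.lookup f u = (\<Sum>m | c m \<noteq> 0. Poly_Mapping.lookup (c m) u)"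
    by (simp add: lookup_sum)
  also have "\<dots> = (\<Sum>m | c m \<noteq> 0. if m = n then Poly_Mapping.lookup (c n) u else 0)"
  proof (intro sum.cong refl)
    fix m
    have "u \<notin> Poly_Mapping.keys (c m)" if "m \<noteq> n"
    proof
      assume "u \<in> Poly_Mapping.keys (c m)"
      then have "m * int d = n * int d" using c(1)[of m] c(1)[of n] u by force
      then show False using d_pos that by simp
    qed
    then show "Poly_Mapping.lookup (c m) u = (if m = n then Poly_Mapping.lookup (c n) u else 0)"
      by (auto simp: in_keys_iff)
  qed
  also have "\<dots> = Poly_Mapping.lookup (c n) u" using u c(2) by (auto simp: in_keys_iff)
  finally show "u \<in> Poly_Mapping.keys f" using u by (simp add: in_keys_iff)
qed

lemma components_\<epsilon>:
  assumes "f \<in> carrier R" "components (I 0) (\<epsilon> f) c"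
  obtains e where "components (self_module R) f e" "c = (\<lambda>n. \<epsilon> (e n))"
proof -
  obtain e where e: "components (self_module R) f e"
    using is_graded_moduleD(6)[OF self_graded, of f] assms(1) by auto
  have "c = (\<lambda>n. \<epsilon> (e n))"
    using components_hom[OF self_graded I_graded \<epsilon>_hom e] assms(2)
      is_graded_moduleD(6)[OF I_graded, of "\<epsilon> f" 0] graded_homD(1)[OF \<epsilon>_hom] assms(1) by auto
  then show ?thesis using that e by blast
qed

lemma \<epsilon>_closed: "f \<in> carrier R \<Longrightarrow> \<epsilon> f \<in> carrier (I 0)"
  using graded_homD(1)[OF \<epsilon>_hom] by simp

lemma \<epsilon>_mult: "r \<in> carrier R \<Longrightarrow> f \<in> carrier R \<Longrightarrow> \<epsilon> (r * f) = r \<odot>\<^bsub>I 0\<^esub> \<epsilon> f"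
  using graded_homD(3)[OF \<epsilon>_hom, of r f] by simp

lemma \<epsilon>_add: "f \<in> carrier R \<Longrightarrow> g \<in> carrier R \<Longrightarrow> \<epsilon> (f + g) = \<epsilon> f \<oplus>\<^bsub>I 0\<^esub> \<epsilon> g"
  using graded_homD(2)[OF \<epsilon>_hom, of f g] by simp

lemma \<epsilon>_zero: "\<epsilon> 0 = \<zero>\<^bsub>I 0\<^esub>"
  using hom_zero[OF \<epsilon>_hom self_group I_group] by simp

lemma \<epsilon>_homogeneous:
  assumes "f \<in> carrier R" "\<epsilon> f \<in> piece (I 0) n"
  shows "f \<in> ring_piece R n"
proof -
  obtain f' where f': "f' \<in> piece (self_module R) n" "\<epsilon> f' = \<epsilon> f"
    using homogeneous_preimage[OF self_graded I_graded \<epsilon>_hom, of f n] assms by auto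
  then have "f' \<in> carrier R" by auto
  then show ?thesis using f' inj_onD[OF \<epsilon>_inj f'(2)] assms(1) by simp
qed

lemma \<delta>_\<epsilon>: "f \<in> carrier R \<Longrightarrow> \<delta> 0 (\<epsilon> f) = \<zero>\<^bsub>I 1\<^esub>"
  using exact_0 by blast

section \<open>Torsion, coboundaries and cosets\<close>

lemma torsion_minus:
  assumes "x \<in> torsion R \<mm> (I i)" "y \<in> torsion R \<mm> (I i)"
  shows "x \<ominus>\<^bsub>I i\<^esub> y \<in> torsion R \<mm> (I i)"
proof -
  interpret M: Module.module R "I i" by (rule module_I)
  obtain m where m: "\<And>r. r \<in> ideal_power R \<mm> m \<Longrightarrow> r \<odot>\<^bsub>I i\<^esub> x = \<zero>\<^bsub>I i\<^esub>"
    using assms(1) by (auto simp: torsion_def)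
  obtain n where n: "\<And>r. r \<in> ideal_power R \<mm> n \<Longrightarrow> r \<odot>\<^bsub>I i\<^esub> y = \<zero>\<^bsub>I i\<^esub>"
    using assms(2) by (auto simp: torsion_def)
  have xy: "x \<in> carrier (I i)" "y \<in> carrier (I i)" using assms by (auto simp: torsion_def)
  \<comment> \<open>The powers of \<open>\<mm>\<close> decrease, so the larger exponent annihilates
    both elements.\<close>
  have "r \<odot>\<^bsub>I i\<^esub> (x \<ominus>\<^bsub>I i\<^esub> y) = \<zero>\<^bsub>I i\<^esub>" if r: "r \<in> ideal_power R \<mm> (max m n)" for r
  proof -
    have "r \<in> ideal_power R \<mm> m" "r \<in> ideal_power R \<mm> n"
      using r R.ideal_power_antimono[OF mm_ideal, of m "max m n"]
        R.ideal_power_antimono[OF mm_ideal, of n "max m n"] by auto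
    moreover have "r \<in> carrier R"
      using r ideal.Icarr[OF R.ideal_power_ideal[OF mm_ideal]] by blast
    ultimately show ?thesis
      using m n xy by (simp add: a_minus_def M.smult_r_distr M.smult_r_minus del: R_simps)
  qed
  then show ?thesis using xy by (auto simp: torsion_def)
qed

lemma torsion_subgroup: "additive_subgroup (torsion R \<mm> (I i)) (I i)"
proof -
  interpret M: Module.module R "I i" by (rule module_I)
  have z: "\<zero>\<^bsub>I i\<^esub> \<in> torsion R \<mm> (I i)"
    using ideal.Icarr[OF R.ideal_power_ideal[OF mm_ideal]]
    by (auto simp: torsion_def simp del: R_simps intro!: exI[of _ 0])
  have neg: "\<ominus>\<^bsub>I i\<^esub> y \<in> torsion R \<mm> (I i)" if "y \<in> torsion R \<mm> (I i)" for y
    using torsion_minus[OF z that] that by (simp add: a_minus_def torsion_def)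
  show ?thesis
  proof (rule additive_subgroupI, rule M.M.add.subgroupI, goal_cases)
    case (3 y)
    then show ?case using neg by (simp add: a_inv_def)
  next
    case (4 x y)
    then show ?case using torsion_minus[OF 4(1) neg[OF 4(2)]] by (simp add: a_minus_def torsion_def)
  qed (use z in \<open>auto simp: torsion_def\<close>)
qed

lemma coboundaries_1: "coboundaries R \<mm> I \<delta> 1 = \<delta> 0 ` torsion R \<mm> (I 0)"
  by (simp add: coboundaries_def)

lemma coboundaries_subgroup: "additive_subgroup (coboundaries R \<mm> I \<delta> 1) (I 1)"
proof -
  interpret M: abelian_group "I 0" by (rule I_group)
  interpret N: abelian_group "I 1" by (rule I_group)
  interpret T: additive_subgroup "torsion R \<mm> (I 0)" "I 0" by (rule torsion_subgroup)
  note hom = graded_homD(1,2)[OF \<delta>_hom[of 0, folded One_nat_def]]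
  have zero: "\<delta> 0 \<zero>\<^bsub>I 0\<^esub> = \<zero>\<^bsub>I 1\<^esub>"
    using hom_zero[OF \<delta>_hom I_group I_group, of 0] by simp
  show ?thesis unfolding coboundaries_1
  proof (rule additive_subgroupI, rule N.add.subgroupI, goal_cases)
    case 1
    then show ?case using hom(1) by auto
  next
    case 2
    then show ?case using T.zero_closed by blast
  next
    case (3 x)
    then obtain y where y: "y \<in> torsion R \<mm> (I 0)" "x = \<delta> 0 y" by blast
    have "\<delta> 0 (\<ominus>\<^bsub>I 0\<^esub> y) \<oplus>\<^bsub>I 1\<^esub> \<delta> 0 y = \<zero>\<^bsub>I 1\<^esub>"
      using hom(2)[of "\<ominus>\<^bsub>I 0\<^esub> y" y] y(1) zero by (simp add: M.l_neg)
    then have "\<ominus>\<^bsub>I 1\<^esub> x = \<delta> 0 (\<ominus>\<^bsub>I 0\<^esub> y)"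
      unfolding y(2) using y(1) hom(1) by (intro N.minus_equality) auto
    then show ?case using T.a_inv_closed[OF y(1)] by (simp add: a_inv_def)
  next
    case (4 x x')
    then obtain y y' where y: "y \<in> torsion R \<mm> (I 0)" "x = \<delta> 0 y"
      "y' \<in> torsion R \<mm> (I 0)" "x' = \<delta> 0 y'" by blast
    then have "x \<oplus>\<^bsub>I 1\<^esub> x' = \<delta> 0 (y \<oplus>\<^bsub>I 0\<^esub> y')"
      using hom(2) T.a_Hcarr by simp
    then show ?case using T.a_closed[OF y(1,3)] by simp
  qed
qed

lemma local_cohomology_piece_nonzero_iff:
  "local_cohomology_piece R \<mm> I \<delta> 1 n \<noteq> {coboundaries R \<mm> I \<delta> 1} \<longleftrightarrow>
     (\<exists>x \<in> cocycles R \<mm> I \<delta> 1 \<inter> piece (I 1) n. x \<notin> coboundaries R \<mm> I \<delta> 1)"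
proof -
  interpret N: abelian_group "I 1" by (rule I_group)
  interpret T: additive_subgroup "coboundaries R \<mm> I \<delta> 1" "I 1" by (rule coboundaries_subgroup)
  have coset: "coboundaries R \<mm> I \<delta> 1 +>\<^bsub>I 1\<^esub> x = coboundaries R \<mm> I \<delta> 1 \<longleftrightarrow> x \<in> coboundaries R \<mm> I \<delta> 1"
    if "x \<in> cocycles R \<mm> I \<delta> 1" for x
  proof
    assume "coboundaries R \<mm> I \<delta> 1 +>\<^bsub>I 1\<^esub> x = coboundaries R \<mm> I \<delta> 1"
    moreover have "\<zero>\<^bsub>I 1\<^esub> \<oplus>\<^bsub>I 1\<^esub> x \<in> coboundaries R \<mm> I \<delta> 1 +>\<^bsub>I 1\<^esub> x"
      unfolding a_r_coset_def' using T.zero_closed by blast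
    moreover have "x \<in> carrier (I 1)" using that by (simp add: cocycles_def torsion_def)
    ultimately show "x \<in> coboundaries R \<mm> I \<delta> 1" by (simp only: N.l_zero)
  next
    assume "x \<in> coboundaries R \<mm> I \<delta> 1"
    then show "coboundaries R \<mm> I \<delta> 1 +>\<^bsub>I 1\<^esub> x = coboundaries R \<mm> I \<delta> 1"
      using N.a_coset_join2[OF T.a_Hcarr T.a_subgroup] by blast
  qed
  \<comment> \<open>The set of homogeneous cocycles is nonempty, so its image is a singleton iff all
    its cosets are trivial.\<close>
  have "\<zero>\<^bsub>I 1\<^esub> \<in> cocycles R \<mm> I \<delta> 1 \<inter> piece (I 1) n"
    using additive_subgroup.zero_closed[OF torsion_subgroup] piece_zero[OF I_graded]
      hom_zero[OF \<delta>_hom I_group I_group, of 1] by (simp add: cocycles_def)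
  then have "local_cohomology_piece R \<mm> I \<delta> 1 n = {coboundaries R \<mm> I \<delta> 1} \<longleftrightarrow>
      (\<forall>x \<in> cocycles R \<mm> I \<delta> 1 \<inter> piece (I 1) n.
        coboundaries R \<mm> I \<delta> 1 +>\<^bsub>I 1\<^esub> x = coboundaries R \<mm> I \<delta> 1)"
    unfolding local_cohomology_piece_def by (rule image_eq_singleton_iff)
  then show ?thesis using coset by (metis IntD1)
qed

text \<open>If \<open>x\<close> is the image of \<open>y\<close>, then \<open>r y\<close> lies in \<open>\<epsilon> R\<close> for all \<open>r\<close> in a power of \<open>\<mm>\<close>.
  Dividing by two monomials \<open>(0, N d)\<close> and \<open>(N d, 0)\<close> shows that \<open>r y = \<epsilon> (r F)\<close> for one
  Laurent polynomial \<open>F\<close> with support in the saturation.\<close>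

lemma cocycle_is_coboundary:
  assumes no_gap: "\<And>u. u \<in> saturation \<Longrightarrow> int (fst u + snd u) = n * int d \<Longrightarrow> u \<in> S"
    and x: "x \<in> cocycles R \<mm> I \<delta> 1" "x \<in> piece (I 1) n"
  shows "x \<in> coboundaries R \<mm> I \<delta> 1"
proof -
  interpret M: Module.module R "I 0" by (rule module_I)
  interpret N: Module.module R "I 1" by (rule module_I)
  note \<delta>0 = \<delta>_hom[of 0, folded One_nat_def]
  note \<delta>0D = graded_homD[OF \<delta>0]
  have "x \<in> \<delta> 0 ` carrier (I 0)"
    unfolding exact using x(1) by (simp add: cocycles_def torsion_def)
  then obtain y0 where "y0 \<in> carrier (I 0)" "\<delta> 0 y0 = x" by blast
  \<comment> \<open>Taking the preimage homogeneous of degree \<open>n\<close> confines the support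
    of \<open>F\<close> below to degree \<open>n\<close>, where \<open>no_gap\<close>
    applies.\<close>
  then obtain y where y: "y \<in> piece (I 0) n" "\<delta> 0 y = x"
    using homogeneous_preimage[OF I_graded I_graded \<delta>0, of y0 n] x(2) by auto
  then have yc: "y \<in> carrier (I 0)" using piece_carrier[OF I_graded] by blast
  obtain N where N: "\<And>r. r \<in> ideal_power R \<mm> N \<Longrightarrow> r \<odot>\<^bsub>I 1\<^esub> x = \<zero>\<^bsub>I 1\<^esub>"
    using x(1) by (auto simp: cocycles_def torsion_def)
  have power_carrier: "r \<in> carrier R" if "r \<in> ideal_power R \<mm> N" for r
    using that ideal.Icarr[OF R.ideal_power_ideal[OF mm_ideal]] by blast
  have lift: "\<exists>h\<in>carrier R. \<epsilon> h = r \<odot>\<^bsub>I 0\<^esub> y" if r: "r \<in> ideal_power R \<mm> N" for r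
  proof -
    have "\<delta> 0 (r \<odot>\<^bsub>I 0\<^esub> y) = \<zero>\<^bsub>I 1\<^esub>"
      using \<delta>0D(3)[OF power_carrier[OF r] yc] y(2) N[OF r] by simp
    then have "r \<odot>\<^bsub>I 0\<^esub> y \<in> \<epsilon> ` carrier R"
      unfolding exact_0 using M.smult_closed[OF power_carrier[OF r] yc] by blast
    then show ?thesis by auto
  qed
  define p q :: "nat \<times> nat" where "p = (0, N * d)" and "q = (N * d, 0)"
  have pS: "p \<in> S" using S_left by (simp add: p_def)
  have pN: "monomial p \<in> ideal_power R \<mm> N" and qN: "monomial q \<in> ideal_power R \<mm> N"
    using monomial_left monomial_right by (simp_all add: p_def q_def)
  have pR: "monomial p \<in> carrier R" and qR: "monomial q \<in> carrier R"
    using power_carrier pN qN by blast+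
  obtain f where f: "f \<in> carrier R" "\<epsilon> f = monomial p \<odot>\<^bsub>I 0\<^esub> y" using lift[OF pN] by blast
  obtain g where g: "g \<in> carrier R" "\<epsilon> g = monomial q \<odot>\<^bsub>I 0\<^esub> y" using lift[OF qN] by blast
  have swap: "r \<odot>\<^bsub>I 0\<^esub> (s \<odot>\<^bsub>I 0\<^esub> y) = s \<odot>\<^bsub>I 0\<^esub> (r \<odot>\<^bsub>I 0\<^esub> y)"
    if "r \<in> carrier R" "s \<in> carrier R" for r s
    using M.smult_assoc1[OF that yc] M.smult_assoc1[OF that(2,1) yc] by (simp add: mult.commute)
  \<comment> \<open>Under the injective map \<open>\<epsilon>\<close> both sides go to
    \<open>r s y\<close>.\<close>
  have cross: "s * h = r * h'"
    if "r \<in> carrier R" "s \<in> carrier R" "h \<in> carrier R" "h' \<in> carrier R"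
      "\<epsilon> h = r \<odot>\<^bsub>I 0\<^esub> y" "\<epsilon> h' = s \<odot>\<^bsub>I 0\<^esub> y" for r s h h'
  proof (rule inj_onD[OF \<epsilon>_inj])
    show "\<epsilon> (s * h) = \<epsilon> (r * h')" using that swap by (simp add: \<epsilon>_mult del: R_simps)
    show "s * h \<in> carrier R" "r * h' \<in> carrier R"
      using R.m_closed that(1-4) by (simp_all del: R_simps add: R_simps(2)[symmetric])
  qed
  have fg: "monomial q * f = monomial p * g" using cross[OF pR qR f(1) g(1) f(2) g(2)] .
  have f_deg: "f \<in> ring_piece R (int N + n)"
  proof (rule \<epsilon>_homogeneous[OF f(1)])
    have "monomial p \<in> ring_piece R (int N)" using pS by (simp add: p_def)
    then show "\<epsilon> f \<in> piece (I 0) (int N + n)"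
      unfolding f(2) by (rule is_graded_moduleD(5)[OF I_graded _ y(1)])
  qed
  have "Poly_Mapping.keys f \<subseteq> (+) p ` S"
  proof
    fix u assume u: "u \<in> Poly_Mapping.keys f"
    then have "q + u \<in> Poly_Mapping.keys (monomial p * g)"
      unfolding fg[symmetric] keys_single_mult by blast
    then obtain w where w: "w \<in> Poly_Mapping.keys g" "q + u = p + w"
      unfolding keys_single_mult by blast
    have uS: "u \<in> S" and wS: "w \<in> S" using u w(1) f(1) g(1) by auto
    \<comment> \<open>Adding \<open>p\<close> affects only second coordinates, adding
      \<open>q\<close> only first ones. So \<open>v\<close> has its first coordinate from the
      support of \<open>f\<close> and its second from that of \<open>g\<close>.\<close>
    define v where "v = (fst u, snd w)"
    have uv: "u = p + v"
      using w(2) by (cases u; cases w) (simp add: v_def p_def q_def)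
    have "int (fst u + snd u) = (int N + n) * int d" using f_deg u by auto
    then have vn: "int (fst v + snd v) = n * int d" by (simp add: uv p_def algebra_simps)
    then have "d dvd fst v + snd v"
      by (metis dvd_triv_right int_dvd_int_iff)
    then have "v \<in> saturation"
      using S_fst[OF uS] S_snd[OF wS] by (simp add: saturation_def v_def)
    then have "v \<in> S" using no_gap vn by blast
    then show "u \<in> (+) p ` S" using uv by blast
  qed
  then obtain F where F: "Poly_Mapping.keys F \<subseteq> S" "f = monomial p * F"
    using single_mult_factor by blast
  then have FR: "F \<in> carrier R" by simp
  have rF: "\<epsilon> (r * F) = r \<odot>\<^bsub>I 0\<^esub> y" if r: "r \<in> ideal_power R \<mm> N" for r
  proof -
    obtain h where h: "h \<in> carrier R" "\<epsilon> h = r \<odot>\<^bsub>I 0\<^esub> y" using lift[OF r] by blast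
    have "monomial p * h = r * f" using cross[OF power_carrier[OF r] pR h(1) f(1) h(2) f(2)] .
    also have "\<dots> = monomial p * (r * F)" by (simp add: F(2) ac_simps)
    finally show ?thesis using single_mult_cancel h(2) by blast
  qed
  \<comment> \<open>Subtracting \<open>\<epsilon> F\<close>, which \<open>\<delta> 0\<close> kills,
    keeps the image \<open>x\<close>, and \<open>rF\<close> makes the difference torsion.\<close>
  let ?z = "y \<ominus>\<^bsub>I 0\<^esub> \<epsilon> F"
  have "r \<odot>\<^bsub>I 0\<^esub> ?z = \<zero>\<^bsub>I 0\<^esub>" if r: "r \<in> ideal_power R \<mm> N" for r
    using rF[OF r] \<epsilon>_mult[OF power_carrier[OF r] FR] yc \<epsilon>_closed[OF FR] power_carrier[OF r]
    by (simp add: a_minus_def M.smult_r_distr M.smult_r_minus M.M.r_neg del: R_simps)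
  then have "?z \<in> torsion R \<mm> (I 0)"
    using yc \<epsilon>_closed[OF FR] by (auto simp: torsion_def)
  moreover have "\<ominus>\<^bsub>I 1\<^esub> \<zero>\<^bsub>I 1\<^esub> = \<zero>\<^bsub>I 1\<^esub>"
    by (rule N.M.minus_equality) (rule N.M.l_zero N.M.zero_closed)+
  then have "\<delta> 0 ?z = x"
    using hom_minus[OF \<delta>0 I_group I_group yc \<epsilon>_closed[OF FR]] \<delta>_\<epsilon>[OF FR] y(2) piece_carrier[OF I_graded x(2)]
    by (simp only: a_minus_def N.M.r_zero)
  ultimately show ?thesis unfolding coboundaries_1 by blast
qed

text \<open>Multiplication by \<open>u\<close> maps the ideal of all \<open>f\<close> with \<open>u f \<in> R\<close>, which contains a power of
  \<open>\<mm>\<close>, to \<open>R\<close>. An extension of this map to \<open>R \<rightarrow> I 0\<close> sends \<open>1\<close> to an element \<open>y\<close> whose image in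
  \<open>I 1\<close> is the required cocycle. The test modules are copies of the ideal and of \<open>R\<close> inside \<open>I 0\<close>,
  because injectivity is only available for modules with elements in the type of \<open>I\<close>.\<close>

lemma gap_gives_cocycle:
  assumes u: "u \<in> saturation - S" "int (fst u + snd u) = n * int d"
  shows "\<exists>x \<in> cocycles R \<mm> I \<delta> 1 \<inter> piece (I 1) n. x \<notin> coboundaries R \<mm> I \<delta> 1"
proof -
  interpret M: Module.module R "I 0" by (rule module_I)
  interpret N: Module.module R "I 1" by (rule module_I)
  note \<delta>0 = \<delta>_hom[of 0, folded One_nat_def]
  note \<delta>0D = graded_homD[OF \<delta>0]
  define \<aa> :: "((nat \<times> nat) \<Rightarrow>\<^sub>0 'k) set" where "\<aa> = {f. Poly_Mapping.keys f \<subseteq> {s \<in> S. u + s \<in> S}}"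
  have aR: "\<aa> \<subseteq> carrier R" by (auto simp: \<aa>_def)
  have a_add: "f + g \<in> \<aa>" if "f \<in> \<aa>" "g \<in> \<aa>" for f g
    using that keys_add[of f g] by (auto simp: \<aa>_def)
  have a_mult: "r * f \<in> \<aa>" if "r \<in> carrier R" "f \<in> \<aa>" for r f
  proof -
    have "s + t \<in> S \<and> u + (s + t) \<in> S" if "s \<in> Poly_Mapping.keys r" "t \<in> Poly_Mapping.keys f" for s t
    proof -
      have "s \<in> S" "t \<in> S" "u + t \<in> S" using that \<open>r \<in> carrier R\<close> \<open>f \<in> \<aa>\<close> by (auto simp: \<aa>_def)
      then show ?thesis using S_plus[of s t] S_plus[of s "u + t"] by (simp add: ac_simps)
    qed
    then show ?thesis using keys_mult[of r f] by (fastforce simp: \<aa>_def)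
  qed
  have R_piece: "ring_piece R m \<subseteq> carrier R" for m by auto
  define A where "A = shifted_submodule (I 0) (\<epsilon> ` \<aa>) n"
  define B where "B = shifted_submodule (I 0) (\<epsilon> ` carrier R) n"
  \<comment> \<open>The closure of \<open>C\<close> under shrinking supports yields closure under
    homogeneous components.\<close>
  have graded: "is_graded_module R (shifted_submodule (I 0) (\<epsilon> ` C) n)"
    if C: "C \<subseteq> carrier R" "0 \<in> C" "\<And>f g. f \<in> C \<Longrightarrow> g \<in> C \<Longrightarrow> f + g \<in> C"
      "\<And>r f. r \<in> carrier R \<Longrightarrow> f \<in> C \<Longrightarrow> r * f \<in> C"
      "\<And>f g. f \<in> C \<Longrightarrow> Poly_Mapping.keys g \<subseteq> Poly_Mapping.keys f \<Longrightarrow> g \<in> C" for C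
  proof (rule shifted_submodule_graded[OF I_graded R_piece])
    show "\<epsilon> ` C \<subseteq> carrier (I 0)" using C(1) \<epsilon>_closed by blast
    show "\<zero>\<^bsub>I 0\<^esub> \<in> \<epsilon> ` C" using C(2) \<epsilon>_zero by (metis imageI)
    show "x \<oplus>\<^bsub>I 0\<^esub> y \<in> \<epsilon> ` C" if xy: "x \<in> \<epsilon> ` C" "y \<in> \<epsilon> ` C" for x y
    proof -
      obtain f g where fg: "f \<in> C" "g \<in> C" "x = \<epsilon> f" "y = \<epsilon> g" using xy by blast
      then have "x \<oplus>\<^bsub>I 0\<^esub> y = \<epsilon> (f + g)" using \<epsilon>_add[of f g] C(1) by (simp add: subset_iff del: R_simps)
      then show ?thesis using C(3) fg by blast
    qed
    show "r \<odot>\<^bsub>I 0\<^esub> x \<in> \<epsilon> ` C" if r: "r \<in> carrier R" "x \<in> \<epsilon> ` C" for r x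
    proof -
      obtain f where f: "f \<in> C" "x = \<epsilon> f" using r by blast
      then have "r \<odot>\<^bsub>I 0\<^esub> x = \<epsilon> (r * f)" using \<epsilon>_mult[of r f] C(1) r(1) by (simp add: subset_iff del: R_simps)
      then show ?thesis using C(4) f r(1) by blast
    qed
    show "c j \<in> \<epsilon> ` C" if xc: "x \<in> \<epsilon> ` C" "components (I 0) x c" for x c j
    proof -
      obtain f where f: "f \<in> C" "x = \<epsilon> f" using xc by blast
      then obtain e where e: "components (self_module R) f e" "c = (\<lambda>n. \<epsilon> (e n))"
        using components_\<epsilon>[of f c] C(1) xc(2) by blast
      then show ?thesis using C(5)[OF f(1) components_self_keys[OF e(1)]] by simp
    qed
  qed
  have A: "is_graded_module R A" unfolding A_def
    by (rule graded) (use aR a_add a_mult in \<open>auto simp: \<aa>_def\<close>)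
  have B: "is_graded_module R B" unfolding B_def
    by (rule graded) (use R.a_closed R.m_closed in auto)
  \<comment> \<open>Multiplication by the monomial of \<open>u\<close>, transported along
    \<open>\<epsilon>\<close>; the degree \<open>n\<close> of \<open>u\<close> is compensated by the
    shift in \<open>A\<close>.\<close>
  define \<phi> where "\<phi> = (\<lambda>z. \<epsilon> (monomial u * inv_into (carrier R) \<epsilon> z))"
  have \<phi>: "\<phi> (\<epsilon> f) = \<epsilon> (monomial u * f)" if "f \<in> carrier R" for f
    unfolding \<phi>_def using inv_into_f_f[OF \<epsilon>_inj that] by simp
  have uR: "monomial u * f \<in> carrier R" if "f \<in> \<aa>" for f
    using that by (auto simp: \<aa>_def keys_single_mult)
  have "\<phi> \<in> graded_hom R A (I 0)"
    unfolding graded_hom_def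
  proof (intro CollectI conjI ballI allI subsetI funcsetI)
    fix x assume "x \<in> carrier A"
    then show "\<phi> x \<in> carrier (I 0)" using \<phi> aR \<epsilon>_closed uR by (auto simp: A_def simp del: R_simps)
  next
    fix x y assume "x \<in> carrier A" "y \<in> carrier A"
    then obtain f g where fg: "f \<in> \<aa>" "g \<in> \<aa>" "x = \<epsilon> f" "y = \<epsilon> g" by (auto simp: A_def)
    then have R: "f \<in> carrier R" "g \<in> carrier R" "f + g \<in> carrier R" using aR a_add by blast+
    show "\<phi> (x \<oplus>\<^bsub>A\<^esub> y) = \<phi> x \<oplus>\<^bsub>I 0\<^esub> \<phi> y"
      using \<phi>[OF R(1)] \<phi>[OF R(2)] \<phi>[OF R(3)] \<epsilon>_add[OF R(1,2)] \<epsilon>_add[OF uR[OF fg(1)] uR[OF fg(2)]] fg(3,4)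
      by (simp add: A_def distrib_left)
  next
    fix r x assume r: "r \<in> carrier R" and "x \<in> carrier A"
    then obtain f where f: "f \<in> \<aa>" "x = \<epsilon> f" by (auto simp: A_def)
    then have R: "f \<in> carrier R" "r * f \<in> carrier R" using aR a_mult r by blast+
    show "\<phi> (r \<odot>\<^bsub>A\<^esub> x) = r \<odot>\<^bsub>I 0\<^esub> \<phi> x"
      using \<phi>[OF R(1)] \<phi>[OF R(2)] \<epsilon>_mult[OF r R(1)] \<epsilon>_mult[OF r uR[OF f(1)]] f(2)
      by (simp add: A_def ac_simps)
  next
    fix j z assume "z \<in> \<phi> ` piece A j"
    then obtain f where f: "f \<in> \<aa>" "\<epsilon> f \<in> piece (I 0) (j - n)" "z = \<phi> (\<epsilon> f)" by (auto simp: A_def)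
    then have fR: "f \<in> carrier R" using aR by blast
    have "f \<in> ring_piece R (j - n)" using \<epsilon>_homogeneous[OF fR f(2)] .
    then have "monomial u * f \<in> ring_piece R j"
      using u(2) uR[OF f(1)] by (auto simp: keys_single_mult left_diff_distrib)
    then have "\<epsilon> (monomial u * f) \<in> piece (I 0) j"
      by (intro graded_homD(4)[OF \<epsilon>_hom]) simp
    then show "z \<in> piece (I 0) j" using f(3) \<phi>[OF fR] by simp
  qed
  moreover have "id \<in> graded_hom R A B"
    using aR by (auto simp: graded_hom_def A_def B_def)
  ultimately obtain h where h: "h \<in> graded_hom R B (I 0)" "\<And>x. x \<in> carrier A \<Longrightarrow> h (id x) = \<phi> x"
    using I_injective[of 0] A B unfolding graded_injective_def by (meson inj_on_id)
  have one: "1 \<in> carrier R" using R.one_closed by simp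
  \<comment> \<open>The shift gives \<open>\<epsilon> 1\<close> degree \<open>n\<close> in
    \<open>B\<close>, so \<open>y\<close> has degree \<open>n\<close> in \<open>I 0\<close>.\<close>
  define y where "y = h (\<epsilon> 1)"
  have "\<epsilon> 1 \<in> piece (I 0) 0"
    using S_zero by (intro graded_homD(4)[OF \<epsilon>_hom]) (simp add: zero_prod_def)
  then have y: "y \<in> piece (I 0) n"
    unfolding y_def using one by (intro graded_homD(4)[OF h(1)]) (auto simp: B_def simp del: R_simps)
  then have yc: "y \<in> carrier (I 0)" using piece_carrier[OF I_graded] by blast
  have ry: "r \<odot>\<^bsub>I 0\<^esub> y = \<epsilon> (monomial u * r)" if r: "r \<in> \<aa>" for r
  proof -
    have rR: "r \<in> carrier R" using r aR by blast
    have "r \<odot>\<^bsub>I 0\<^esub> y = h (r \<odot>\<^bsub>B\<^esub> \<epsilon> 1)"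
      unfolding y_def using one rR by (intro graded_homD(3)[OF h(1), symmetric]) (auto simp: B_def simp del: R_simps)
    also have "r \<odot>\<^bsub>B\<^esub> \<epsilon> 1 = \<epsilon> r" using \<epsilon>_mult[OF rR one] by (simp add: B_def)
    also have "h (\<epsilon> r) = \<phi> (\<epsilon> r)" using h(2)[of "\<epsilon> r"] r by (simp add: A_def)
    finally show ?thesis using \<phi>[OF rR] by simp
  qed
  obtain M where "\<And>s. s \<in> S \<Longrightarrow> M * d \<le> fst s + snd s \<Longrightarrow> u + s \<in> S"
    using saturation_absorbs u(1) by blast
  then have "high_degree M \<subseteq> \<aa>" by (auto simp: high_degree_def \<aa>_def)
  then have Ma: "ideal_power R \<mm> M \<subseteq> \<aa>" using ideal_power_high_degree by blast
  define x where "x = \<delta> 0 y"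
  have "x \<in> piece (I 1) n" unfolding x_def using \<delta>0D(4)[OF y] .
  \<comment> \<open>For \<open>r\<close> in a power of \<open>\<mm>\<close> inside
    \<open>\<aa>\<close>, the element \<open>r y\<close> is in the image of
    \<open>\<epsilon>\<close> and thus killed by \<open>\<delta> 0\<close>.\<close>
  moreover have "x \<in> cocycles R \<mm> I \<delta> 1"
  proof -
    have "r \<odot>\<^bsub>I 1\<^esub> x = \<zero>\<^bsub>I 1\<^esub>" if "r \<in> ideal_power R \<mm> M" for r
    proof -
      have r: "r \<in> \<aa>" using that Ma by blast
      then show ?thesis
        using \<delta>0D(3)[OF _ yc, of r] ry[OF r] \<delta>_\<epsilon>[OF uR[OF r]] aR by (auto simp: x_def simp del: R_simps)
    qed
    moreover have "x \<in> carrier (I 1)" "\<delta> 1 x = \<zero>\<^bsub>I (Suc 1)\<^esub>"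
      using exact[of 0] yc by (auto simp: x_def)
    ultimately show ?thesis by (auto simp: cocycles_def torsion_def)
  qed
  moreover have "x \<notin> coboundaries R \<mm> I \<delta> 1"
  proof
    assume "x \<in> coboundaries R \<mm> I \<delta> 1"
    then obtain y' where y': "y' \<in> torsion R \<mm> (I 0)" "x = \<delta> 0 y'" unfolding coboundaries_1 by blast
    then obtain N where N: "\<And>r. r \<in> ideal_power R \<mm> N \<Longrightarrow> r \<odot>\<^bsub>I 0\<^esub> y' = \<zero>\<^bsub>I 0\<^esub>"
      and yc': "y' \<in> carrier (I 0)"
      by (auto simp: torsion_def)
    have "\<delta> 0 (y \<ominus>\<^bsub>I 0\<^esub> y') = \<zero>\<^bsub>I 1\<^esub>"
      using hom_minus[OF \<delta>0 I_group I_group yc yc'] y'(2) \<delta>0D(1)[OF yc]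
      by (simp only: x_def[symmetric] a_minus_def N.M.r_neg)
    then have "y \<ominus>\<^bsub>I 0\<^esub> y' \<in> \<epsilon> ` carrier R" unfolding exact_0 using yc yc' by simp
    then obtain F where F: "F \<in> carrier R" "\<epsilon> F = y \<ominus>\<^bsub>I 0\<^esub> y'" by auto
    \<comment> \<open>This monomial lies in both powers: it annihilates \<open>y'\<close> and
      multiplies \<open>y\<close> into the image of \<open>\<epsilon>\<close>. Comparing
      \<open>r F\<close> with \<open>r y\<close> identifies \<open>F\<close> with the monomial of
      \<open>u\<close>, which is not in \<open>R\<close>.\<close>
    define r where "r = monomial (0, max M N * d)"
    have r: "r \<in> ideal_power R \<mm> M" "r \<in> ideal_power R \<mm> N"
      using monomial_left[of "max M N"] R.ideal_power_antimono[OF mm_ideal, of M "max M N"]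
        R.ideal_power_antimono[OF mm_ideal, of N "max M N"]
      unfolding r_def by auto
    have ra: "r \<in> \<aa>" and rR: "r \<in> carrier R" using r(1) Ma aR by blast+
    have "\<epsilon> (r * F) = \<epsilon> (monomial u * r)"
      using \<epsilon>_mult[OF rR F(1)] F(2) ry[OF ra] N[OF r(2)] yc yc' rR \<epsilon>_closed[OF uR[OF ra]]
      by (simp add: a_minus_def M.smult_r_distr M.smult_r_minus del: R_simps)
    then have "r * F = monomial u * r"
      using inj_onD[OF \<epsilon>_inj _ _ uR[OF ra]] R.m_closed[OF rR F(1)] by simp
    then have "r * F = r * monomial u" by (simp add: mult.commute)
    then have "F = monomial u" unfolding r_def by (rule single_mult_cancel)
    then show False using F(1) u(1) by simp
  qed
  ultimately show ?thesis by blast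
qed

text \<open>The trace of the isomorphism of \<open>H^1\<close> with the quotient of the two
  semigroup rings that the invariant depends on: the degrees with nonzero component.\<close>

lemma local_cohomology_piece_1_iff:
  "local_cohomology_piece R \<mm> I \<delta> 1 n \<noteq> {coboundaries R \<mm> I \<delta> 1} \<longleftrightarrow>
     (\<exists>u\<in>saturation - S. int (fst u + snd u) = n * int d)"
  unfolding local_cohomology_piece_nonzero_iff
  using cocycle_is_coboundary gap_gives_cocycle by blast

end

section \<open>Bounds for the invariant\<close>

theorem theorem4p6:
  fixes k d :: nat and a :: "nat \<Rightarrow> nat"
    and R :: "((nat \<times> nat) \<Rightarrow>\<^sub>0 'k::field) graded_ring"
    and I :: "nat \<Rightarrow> ((nat \<times> nat) \<Rightarrow>\<^sub>0 'k, 'c) graded_module"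
    and \<delta> :: "nat \<Rightarrow> 'c \<Rightarrow> 'c"
    and \<epsilon> :: "((nat \<times> nat) \<Rightarrow>\<^sub>0 'k) \<Rightarrow> 'c"
    and \<mm> :: "((nat \<times> nat) \<Rightarrow>\<^sub>0 'k) set"
  assumes "k \<ge> 3"
    and "a 0 = 0" and "\<And>i. i < k \<Longrightarrow> a i < a (Suc i)" and "a k = d"
    and "Gcd (a ` {1..k}) = 1" and "k < d"
    and "R = semigroup_ring d (curve_monoid k a d)"
    and "\<mm> = max_hom_ideal d (curve_monoid k a d)"
    and "graded_injective_resolution R (self_module R) I \<delta> \<epsilon>"
    and "exceptional k a d \<noteq> {}"
  shows
    "a_invariant R \<mm> I \<delta> 1 \<ge>
       ereal (Max (\<Union>i\<in>exceptional k a d. {delta1_w k a d i, delta2_w k a d i}) - 1) \<and>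
     a_invariant R \<mm> I \<delta> 1 \<le>
       ereal (Max ((\<lambda>i. delta1_w k a d i + delta2_w k a d i - wdeg d (wvec k a d i)) ` exceptional k a d) - 2) \<and>
     a_invariant R \<mm> I \<delta> 1 \<le>
       ereal (real_of_int
         \<lfloor>(1 - real (a 1) / real d) * Max (delta1_w k a d ` exceptional k a d) +
          real (a (k - 1)) / real d * Max (delta2_w k a d ` exceptional k a d)\<rfloor> - 2)"
proof -
  have mono: "i < j \<Longrightarrow> j \<le> k \<Longrightarrow> a i < a j" for i j
  proof (induction j)
    case (Suc j)
    then show ?case using assms(3)[of j] by (cases "i = j") force+
  qed simp
  have mono_le: "i \<le> j \<Longrightarrow> j \<le> k \<Longrightarrow> a i \<le> a j" for i j
    using mono[of i j] by (cases "i = j") auto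
  have d_pos: "d > 0" using assms(6) by simp
  define A where "A = A1 k a"
  interpret monomial_curve d A
  proof
    show "A \<subseteq> {..d}" using mono_le[of _ k] assms(4) by (auto simp: A_def A1_def)
    show "0 \<in> A" unfolding A_def A1_def by (rule image_eqI[of _ _ 0]) (use assms(2) in auto)
    show "d \<in> A" unfolding A_def A1_def by (rule image_eqI[of _ _ k]) (use assms(4) in auto)
  qed (rule d_pos)
  have S_eq: "curve_monoid k a d = S" unfolding curve_monoid_def S_def unfolding A_def A1_def ..
  have B_eq: "A2 k a d = B" unfolding A2_def B_def unfolding A_def A1_def image_image ..
  interpret resolved_curve d A R I \<delta> \<epsilon>
    using assms(7,9) by unfold_locales (simp_all add: S_eq)
  define E where "E = exceptional k a d"
  define p q where "p = (\<lambda>i. delta A (fst (w i)))" and "q = (\<lambda>i. delta B (snd (w i)))"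
  have w_eq: "wvec k a d i = w i" for i by (simp add: wvec_def w_def A_def[symmetric] B_eq)
  have d1: "delta1_w k a d = (\<lambda>i. real (p i))"
    by (simp add: fun_eq_iff delta1_w_def w_eq p_def A_def)
  have d2: "delta2_w k a d = (\<lambda>i. real (q i))"
    by (simp add: fun_eq_iff delta2_w_def w_eq q_def B_eq)
  have wdeg_eq: "wdeg d (w i) = real e" if "fst (w i) + snd (w i) = e * d" for i e
    using that d_pos by (simp add: wdeg_def flip: of_nat_add)
  have A_eq: "A = insert 0 (insert d (a ` {1..k - 1}))"
  proof -
    have "{0..k} = insert 0 (insert k {1..k - 1})" using assms(1) by auto
    then show ?thesis by (simp add: A_def A1_def assms(2,4))
  qed
  have E_iff: "i \<in> E \<longleftrightarrow> 0 < i \<and> i < d \<and> i \<notin> A \<and> wdeg d (w i) < real (p i)" for i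
    using d_pos by (auto simp: E_def exceptional_def A_eq w_eq d1)
  have E_fin: "finite E" by (rule finite_subset[of _ "{..d}"]) (auto simp: E_iff)
  have E_ne: "E \<noteq> {}" using assms(10) by (simp add: E_def)
  have Gcd_A: "Gcd A = 1"
  proof -
    have "{0..k} = insert 0 {1..k}" by auto
    then show ?thesis using assms(5) by (simp add: A_def A1_def assms(2))
  qed
  let ?G = "{n. \<exists>u\<in>saturation - S. int (fst u + snd u) = n * int d}"
  have inv: "a_invariant R \<mm> I \<delta> 1 = (SUP n\<in>?G. ereal (real_of_int n))"
    unfolding a_invariant_def assms(8) S_eq local_cohomology_piece_1_iff ..
  have "ereal (Max (\<Union>i\<in>E. {real (p i), real (q i)}) - 1) \<le> (SUP n\<in>?G. ereal (real_of_int n))"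
  proof -
    have "Max (\<Union>i\<in>E. {real (p i), real (q i)}) \<in> (\<Union>i\<in>E. {real (p i), real (q i)})"
      using E_fin E_ne by (intro Max_in) auto
    then obtain i m where i: "i \<in> E" "m = p i \<or> m = q i"
      and m: "Max (\<Union>i\<in>E. {real (p i), real (q i)}) = real m" by blast
    have ws: "w i \<in> saturation" using w_saturation[OF Gcd_A] i(1) E_iff by blast
    then obtain e where e: "fst (w i) + snd (w i) = e * d"
      unfolding saturation_def by (auto simp: dvd_def mult.commute)
    have "e < p i" using i(1) E_iff wdeg_eq[OF e] by simp
    \<comment> \<open>Exceptional indices are defined through \<open>delta1_w\<close> alone; as
      membership in \<open>S\<close> can be tested on either coordinate, the inequality passes to
      \<open>q i\<close>.\<close>
    moreover from this have "w i \<notin> S"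
      using S_iff_delta[OF _ e] ws by (simp add: p_def saturation_def)
    then have "e < q i"
      using S_iff_delta_dual[OF _ e] ws by (simp add: q_def saturation_def)
    \<comment> \<open>Degree \<open>m - 1\<close> is the last one at which the test with delta value
      \<open>m\<close> fails, and it is at least \<open>e\<close>.\<close>
    ultimately have "\<exists>v\<in>saturation - S. fst v + snd v = (m - 1) * d"
      using gap_left[OF ws e, of "m - 1"] gap_right[OF ws e, of "m - 1"] i(2) by (auto simp: p_def q_def)
    then have "int (m - 1) \<in> ?G" by (auto simp flip: of_nat_mult of_nat_add)
    then have "ereal (real_of_int (int (m - 1))) \<le> (SUP n\<in>?G. ereal (real_of_int n))"
      by (rule SUP_upper)
    moreover have "1 \<le> m" using i(2) \<open>e < p i\<close> \<open>e < q i\<close> by auto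
    ultimately show ?thesis by (simp add: m of_nat_diff)
  qed
  \<comment> \<open>Both upper bounds start from this estimate, in which \<open>e\<close> is the
    degree of \<open>w i\<close>.\<close>
  moreover have upper: "\<exists>i\<in>E. \<exists>e. fst (w i) + snd (w i) = e * d \<and> w i \<in> saturation \<and>
      real_of_int n \<le> real (p i) + real (q i) - real e - 2" if "n \<in> ?G" for n
  proof -
    obtain u where u: "u \<in> saturation - S" "int (fst u + snd u) = n * int d" using \<open>n \<in> ?G\<close> by blast
    have "0 \<le> n" using u(2) d_pos by (metis of_nat_0_le_iff of_nat_0_less_iff zero_le_mult_iff not_less)
    then obtain n' where n': "n = int n'" by (metis nonneg_int_cases)
    then have "fst u + snd u = n' * d" using u(2) by (simp flip: of_nat_mult)
    then obtain j e where "0 < j" "j < d" "j \<notin> A" "w j \<in> saturation" "fst (w j) + snd (w j) = e * d"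
      "e < p j" "n' + e + 2 \<le> p j + q j"
      using gap_upper[OF u(1)] unfolding p_def q_def by metis
    moreover from this have "j \<in> E" by (simp add: E_iff wdeg_eq)
    moreover have "real (n' + e + 2) \<le> real (p j + q j)" using calculation by linarith
    ultimately show ?thesis using n' by (intro bexI[of _ j] exI[of _ e]) auto
  qed
  moreover have "(SUP n\<in>?G. ereal (real_of_int n))
      \<le> ereal (Max ((\<lambda>i. real (p i) + real (q i) - wdeg d (w i)) ` E) - 2)"
  proof (rule SUP_least)
    fix n assume "n \<in> ?G"
    then obtain i e where i: "i \<in> E" "fst (w i) + snd (w i) = e * d"
      "real_of_int n \<le> real (p i) + real (q i) - real e - 2" using upper by blast
    have "real (p i) + real (q i) - wdeg d (w i) \<le> Max ((\<lambda>i. real (p i) + real (q i) - wdeg d (w i)) ` E)"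
      using i(1) E_fin by (intro Max_ge) auto
    then show "ereal (real_of_int n) \<le> ereal (Max ((\<lambda>i. real (p i) + real (q i) - wdeg d (w i)) ` E) - 2)"
      using i(3) wdeg_eq[OF i(2)] by simp
  qed
  moreover have "(SUP n\<in>?G. ereal (real_of_int n)) \<le> ereal (real_of_int
      \<lfloor>(1 - real (a 1) / real d) * Max ((\<lambda>i. real (p i)) ` E) +
        real (a (k - 1)) / real d * Max ((\<lambda>i. real (q i)) ` E)\<rfloor> - 2)"
  proof (rule SUP_least)
    fix n assume "n \<in> ?G"
    then obtain i e where i: "i \<in> E" "fst (w i) + snd (w i) = e * d" "w i \<in> saturation"
      "real_of_int n \<le> real (p i) + real (q i) - real e - 2" using upper by blast
    have p_max: "real (p i) \<le> Max ((\<lambda>i. real (p i)) ` E)" and q_max: "real (q i) \<le> Max ((\<lambda>i. real (q i)) ` E)"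
      using i(1) E_fin by (auto intro!: Max_ge)
    have a1: "a 1 \<le> d" and ak: "a (k - 1) \<le> d"
      using mono_le[of _ k] assms(1,4) by auto
    \<comment> \<open>\<open>a 1\<close> is the least positive element of \<open>A\<close>. For
      \<open>B\<close>, treated next, it is \<open>d - a (k - 1)\<close>, because index
      \<open>k\<close> gives 0.\<close>
    have "a 1 * p i \<le> fst (w i)"
      unfolding p_def
    proof (rule delta_mult_le[OF finite_A])
      show "fst (w i) \<in> generated_monoid A" using i(3) by (simp add: saturation_def)
      fix b assume "b \<in> A - {0}"
      then obtain j where j: "j \<le> k" "b = a j" "a j \<noteq> 0"
        by (auto simp: A_def A1_def)
      then have "1 \<le> j" using assms(2) by (cases j) auto
      then show "a 1 \<le> b" using mono_le j by simp
    qed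
    moreover have "(d - a (k - 1)) * q i \<le> snd (w i)"
      unfolding q_def
    proof (rule delta_mult_le[OF finite_B])
      show "snd (w i) \<in> generated_monoid B" using i(3) by (simp add: saturation_def)
      fix b assume "b \<in> B - {0}"
      then obtain j where j: "j \<le> k" "b = d - a j" "d - a j \<noteq> 0"
        unfolding B_eq[symmetric] by (auto simp: A2_def)
      then have "j \<le> k - 1" using assms(4) by (cases "j = k") auto
      then show "d - a (k - 1) \<le> b" using mono_le[of j "k - 1"] j(2) by simp
    qed
    ultimately have "real (a 1 * p i + (d - a (k - 1)) * q i) \<le> real (e * d)"
      using i(2) by linarith
    then have "real (a 1) * real (p i) + (real d - real (a (k - 1))) * real (q i) \<le> real e * real d"
      using ak by (simp add: of_nat_diff)
    \<comment> \<open>A lower bound for \<open>e\<close>: subtracting it from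
      \<open>p i + q i\<close> leaves the coefficients \<open>1 - a 1 / d\<close> and
      \<open>a (k - 1) / d\<close>.\<close>
    then have "(real (a 1) * real (p i) + (real d - real (a (k - 1))) * real (q i)) / real d \<le> real e"
      using d_pos by (simp add: divide_le_eq)
    also have "(real (a 1) * real (p i) + (real d - real (a (k - 1))) * real (q i)) / real d =
        real (p i) + real (q i) - (1 - real (a 1) / real d) * real (p i) - real (a (k - 1)) / real d * real (q i)"
      using d_pos by (simp add: field_simps)
    finally have "real_of_int (n + 2) \<le>
        (1 - real (a 1) / real d) * real (p i) + real (a (k - 1)) / real d * real (q i)"
      using i(4) by simp
    \<comment> \<open>Both coefficients are nonnegative, so \<open>p i\<close> and
      \<open>q i\<close> may be replaced by their separate maxima.\<close>
    also have "\<dots> \<le> (1 - real (a 1) / real d) * Max ((\<lambda>i. real (p i)) ` E) +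
        real (a (k - 1)) / real d * Max ((\<lambda>i. real (q i)) ` E)"
      using p_max q_max a1 d_pos by (intro add_mono mult_left_mono) auto
    \<comment> \<open>The left side is an integer, so the bound passes to the floor.\<close>
    finally have "n + 2 \<le> \<lfloor>(1 - real (a 1) / real d) * Max ((\<lambda>i. real (p i)) ` E) +
        real (a (k - 1)) / real d * Max ((\<lambda>i. real (q i)) ` E)\<rfloor>"
      by (simp only: le_floor_iff)
    then show "ereal (real_of_int n) \<le> ereal (real_of_int
      \<lfloor>(1 - real (a 1) / real d) * Max ((\<lambda>i. real (p i)) ` E) +
        real (a (k - 1)) / real d * Max ((\<lambda>i. real (q i)) ` E)\<rfloor> - 2)"
      unfolding ereal_less_eq(3) by linarith
  qed
  ultimately show ?thesis
    unfolding inv d1 d2 w_eq E_def[symmetric] by blast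
qed

end
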